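(* Let $V=(A_1,A_2,H,\Phi,E,\sigma_1,\sigma_2,\gamma^{in},\gamma^{out})$ be a two-operator commutative vessel with irreducible discriminant polynomial and discriminant curve $C$. Let $r_1=p_1/p_0$, $r_2=p_2/p_0$, where $p_0,p_1,p_2$ are real polynomials in two variables, be such that $A'_1=r_1(A_1,A_2)$ and $A'_2=r_2(A_1,A_2)$ are defined (that is, $p_0(A_1,A_2)$ is invertible and $A'_i=p_0(A_1,A_2)^{-1}p_i(A_1,A_2)$), and such that $r=(r_1,r_2)$ is a birational isomorphism of $C$ to an irreducible plane algebraic curve $C'$. Let $V'=(A'_1,A'_2,H,\Phi',E',\sigma'_1,\sigma'_2,\gamma'^{in},\gamma'^{out})$ be the vessel defined in the context. Then the discriminant variety $\{(y_1,y_2):\det(y_1\sigma'_2-y_2\sigma'_1+\gamma'^{in})=0\}$ of $V'$ contains $C'$.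
   Context: **Vessels.** Let $H$ be a Hilbert space (finite- or infinite-dimensional) and $E$ a finite-dimensional Hilbert space. A two-operator commutative vessel is a collection $V=(A_1,A_2,H,\Phi,E,\sigma_1,\sigma_2,\gamma^{in},\gamma^{out})$, where $A_1,A_2$ are commuting bounded linear operators on $H$, $\Phi:H\to E$ is a bounded linear map with adjoint $\Phi^*:E\to H$, and $\sigma_1,\sigma_2,\gamma^{in},\gamma^{out}$ are bounded selfadjoint operators on $E$, such that $$\Phi^*\sigma_k\Phi=\tfrac1i(A_k-A_k^* )\quad(k=1,2),$$ $$\gamma^{in}\Phi=\sigma_1\Phi A_2^*-\sigma_2\Phi A_1^*,\qquad \gamma^{out}\Phi=\sigma_1\Phi A_2-\sigma_2\Phi A_1,$$ $$\gamma^{out}=\gamma^{in}+i(\sigma_1\Phi\Phi^*\sigma_2-\sigma_2\Phi\Phi^*\sigma_1).$$ Its discriminant polynomial is $\Delta(y_1,y_2)=\det(y_1\sigma_2-y_2\sigma_1+\gamma^{in})$, and it equals $\det(y_1\sigma_2-y_2\sigma_1+\gamma^{out})$. The zero set of the discriminant polynomial in $\mathbb{C}^2$ is the discriminant variety, called the discriminant curve $C$ when $\Delta$ is irreducible. Put $m=\dim E$, identify $E$ with $\mathbb{C}^m$, and put $\Delta(x_0,x_1,x_2)=\det(x_0\gamma^{in}+x_1\sigma_2-x_2\sigma_1)$, a homogeneous polynomial of degree $m$. It is assumed that $\Delta$ is irreducible (both as a polynomial in $y_1,y_2$ and as a homogeneous polynomial in $x_0,x_1,x_2$). **Birational isomorphism.**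 A rational mapping from $C$ to $C'$ is a birational isomorphism if it has a rational inverse; equivalently, it is one-to-one except at finitely many points. **Homogenization.** Let $n$ be the maximal degree of $p_0,p_1,p_2$, and let $P_k(x_0,x_1,x_2)=x_0^n p_k(x_1/x_0,x_2/x_0)$ be the homogenization of $p_k$ to degree $n$. **Principal subspace.** Let $W_n=\mathbb{C}^{m\,n(n+1)/2}$, whose elements are written $w=(w_{i_1,i_2})_{i_1,i_2\ge 0,\ i_1+i_2\le n-1}$ with $w_{i_1,i_2}\in\mathbb{C}^m=E$. Equivalently the index is $i=(i_0,i_1,i_2)$ with $|i|=i_0+i_1+i_2=n-1$. The principal subspace is $$V_n=\{w\in W_n:\ \sigma_2w_{i_1+1,i_2}-\sigma_1w_{i_1,i_2+1}+\gamma^{in}w_{i_1,i_2}=0\ \text{ for all } i_1,i_2\ge0,\ i_1+i_2\le n-2\}.$$ **Generalized Bezout matrices.** For homogeneous polynomials $p,q$ of degree $n$ in three variables there exist symmetric $\frac{n(n+1)}2\times\frac{n(n+1)}2$ matrices $\beta^{10}=(b^{10}_{ij})$, $\beta^{20}=(b^{20}_{ij})$, $\beta^{12}=(b^{12}_{ij})$, indexed by multi-indices $i,j$ with $|i|=|j|=n-1$, such that $$p(x)q(y)-q(x)p(y)=\sum_{|i|=|j|=n-1}\Big[b^{10}_{ij}x^i(x_1y_0-x_0y_1)y^j+b^{20}_{ij}x^i(x_2y_0-x_0y_2)y^j+b^{12}_{ij}x^i(x_1y_2-x_2y_1)y^j\Big].$$ Put $B(p,q)=\beta^{12}\otimes\gamma^{in}+\beta^{10}\otimes\sigma_1+\beta^{20}\otimes\sigma_2$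 on $W_n$, and let $B'(p,q)=\mathcal{P}_{V_n}B(p,q)\mathcal{P}_{V_n}$, regarded as an operator on $V_n$, where $\mathcal{P}_{V_n}$ is the orthogonal projection of $W_n$ onto $V_n$. **The transformed vessel $V'$.** $$E'=V_n,\qquad \Phi'=\mathcal{P}_{E'}\big(\Phi A_1^{*i_1}A_2^{*i_2}\,p_0(A_1^*,A_2^* )^{-1}\big)_{i_1+i_2\le n-1}:H\to E',$$ $$\sigma'_1=B'(P_1,P_0),\quad \sigma'_2=B'(P_2,P_0),\quad \gamma'^{in}=B'(P_1,P_2),$$ $$\gamma'^{out}=\gamma'^{in}+i(\sigma'_1\Phi'\Phi'^*\sigma'_2-\sigma'_2\Phi'\Phi'^*\sigma'_1).$$ The determinant of an operator on $E'$ is the usual determinant. The discriminant variety of $V'$ may be all of $\mathbb{C}^2$. *)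

theory Defs
  imports
    Complex_Main
    "HOL-Library.Poly_Mapping"
    "HOL-Computational_Algebra.Polynomial_Factorial"
    "Jordan_Normal_Form.Determinant"
begin

section \<open>Complex inner product spaces and Hilbert spaces\<close>

text \<open>The inner product is linear in the first argument.\<close>

class complex_inner = ab_group_add +
  fixes scaleC :: "complex \<Rightarrow> 'a \<Rightarrow> 'a"  (infixr \<open>*\<^sub>C\<close> 75)
    and cinner :: "'a \<Rightarrow> 'a \<Rightarrow> complex"
  assumes scaleC_add_right: "c *\<^sub>C (x + y) = c *\<^sub>C x + c *\<^sub>C y"
    and scaleC_add_left: "(c + d) *\<^sub>C x = c *\<^sub>C x + d *\<^sub>C x"
    and scaleC_scaleC: "c *\<^sub>C (d *\<^sub>C x) = (c * d) *\<^sub>C x"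
    and scaleC_one: "1 *\<^sub>C x = x"
    and cinner_commute: "cinner x y = cnj (cinner y x)"
    and cinner_add_left: "cinner (x + y) z = cinner x z + cinner y z"
    and cinner_scaleC_left: "cinner (c *\<^sub>C x) y = c * cinner x y"
    and cinner_ge_zero: "0 \<le> Re (cinner x x)"
    and cinner_eq_zero_iff: "cinner x x = 0 \<longleftrightarrow> x = 0"

global_interpretation complex_vector:
  vector_space "scaleC :: complex \<Rightarrow> 'a \<Rightarrow> 'a::complex_inner"
  by unfold_locales
    (simp_all add: scaleC_add_right scaleC_add_left scaleC_scaleC scaleC_one)

class chilbert = complex_inner + banach +
  assumes scaleR_scaleC: "r *\<^sub>R x = complex_of_real r *\<^sub>C x"
    and norm_eq_sqrt_cinner: "norm x = sqrt (Re (cinner x x))"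

instantiation complex :: chilbert
begin

definition scaleC_complex :: "complex \<Rightarrow> complex \<Rightarrow> complex"
  where "scaleC_complex c x = c * x"

definition cinner_complex :: "complex \<Rightarrow> complex \<Rightarrow> complex"
  where "cinner_complex x y = x * cnj y"

instance
  by standard
    (simp_all add: scaleC_complex_def cinner_complex_def algebra_simps scaleR_conv_of_real
      norm_complex_def power2_eq_square)

end

text \<open>
  Finitely supported families \<^typ>\<open>'i \<Rightarrow>\<^sub>0 'e\<close> form the orthogonal direct sum of copies
  of \<open>'e\<close>.
\<close>

instantiation poly_mapping :: (type, complex_inner) complex_inner
begin

definition scaleC_poly_mapping :: "complex \<Rightarrow> ('a \<Rightarrow>\<^sub>0 'b) \<Rightarrow> ('a \<Rightarrow>\<^sub>0 'b)"
  where "scaleC_poly_mapping c w = Poly_Mapping.map (scaleC c) w"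

definition cinner_poly_mapping :: "('a \<Rightarrow>\<^sub>0 'b) \<Rightarrow> ('a \<Rightarrow>\<^sub>0 'b) \<Rightarrow> complex"
  where "cinner_poly_mapping v w =
    (\<Sum>i\<in>Poly_Mapping.keys v. cinner (Poly_Mapping.lookup v i) (Poly_Mapping.lookup w i))"

lemma lookup_scaleC:
  "Poly_Mapping.lookup (c *\<^sub>C w) i = c *\<^sub>C Poly_Mapping.lookup (w :: 'a \<Rightarrow>\<^sub>0 'b) i"
  by (simp add: scaleC_poly_mapping_def Poly_Mapping.map.rep_eq when_def)

lemma cinner_zero_left': "cinner (0::'b) y = 0"
  using cinner_scaleC_left[of 0 "0::'b" y] by simp

lemma cinner_zero_right': "cinner y (0::'b) = 0"
  using cinner_commute[of y 0] by (simp add: cinner_zero_left')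

lemma cinner_poly_mapping_superset:
  fixes v w :: "'a \<Rightarrow>\<^sub>0 'b"
  assumes "finite I" "Poly_Mapping.keys v \<subseteq> I"
  shows "cinner v w = (\<Sum>i\<in>I. cinner (Poly_Mapping.lookup v i) (Poly_Mapping.lookup w i))"
  unfolding cinner_poly_mapping_def using assms
  by (intro sum.mono_neutral_left) (auto simp: in_keys_iff cinner_zero_left')

instance
proof
  fix x y z :: "'a \<Rightarrow>\<^sub>0 'b" and c d :: complex
  let ?I = "Poly_Mapping.keys x \<union> Poly_Mapping.keys y"
  show "c *\<^sub>C (x + y) = c *\<^sub>C x + c *\<^sub>C y"
    by (intro poly_mapping_eqI) (simp add: lookup_scaleC lookup_add scaleC_add_right)
  show "(c + d) *\<^sub>C x = c *\<^sub>C x + d *\<^sub>C x"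
    by (intro poly_mapping_eqI) (simp add: lookup_scaleC lookup_add scaleC_add_left)
  show "c *\<^sub>C (d *\<^sub>C x) = (c * d) *\<^sub>C x"
    by (intro poly_mapping_eqI) (simp add: lookup_scaleC scaleC_scaleC)
  show "1 *\<^sub>C x = x"
    by (intro poly_mapping_eqI) (simp add: lookup_scaleC scaleC_one)
  show "cinner x y = cnj (cinner y x)"
    by (simp add: cinner_poly_mapping_superset[of ?I] cinner_commute[symmetric])
  show "cinner (x + y) z = cinner x z + cinner y z"
    using Poly_Mapping.keys_add[of x y]
    by (simp add: cinner_poly_mapping_superset[of ?I] lookup_add cinner_add_left sum.distrib)
  have "Poly_Mapping.keys (c *\<^sub>C x) \<subseteq> Poly_Mapping.keys x"
    by (auto simp: in_keys_iff lookup_scaleC)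
  then show "cinner (c *\<^sub>C x) y = c * cinner x y"
    by (simp add: cinner_poly_mapping_superset[of "Poly_Mapping.keys x"] lookup_scaleC
        cinner_scaleC_left sum_distrib_left)
  show "0 \<le> Re (cinner x x)"
    by (simp add: cinner_poly_mapping_def cinner_ge_zero sum_nonneg)
  show "cinner x x = 0 \<longleftrightarrow> x = 0"
  proof
    assume "cinner x x = 0"
    then have "(\<Sum>i\<in>Poly_Mapping.keys x.
        Re (cinner (Poly_Mapping.lookup x i) (Poly_Mapping.lookup x i))) = 0"
      by (simp add: cinner_poly_mapping_def flip: Re_sum)
    then have *: "Re (cinner (Poly_Mapping.lookup x i) (Poly_Mapping.lookup x i)) = 0"
      if "i \<in> Poly_Mapping.keys x" for i
      using that by (subst (asm) sum_nonneg_eq_0_iff) (auto simp: cinner_ge_zero)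
    have "Im (cinner u u) = 0" for u :: 'b
      using arg_cong[OF cinner_commute[of u u], of Im] by simp
    with * have "Poly_Mapping.lookup x i = 0" if "i \<in> Poly_Mapping.keys x" for i
      using that cinner_eq_zero_iff[of "Poly_Mapping.lookup x i"]
      by (auto simp: complex_eq_iff)
    then show "x = 0"
      by (intro poly_mapping_eqI) (metis in_keys_iff lookup_zero)
  qed (simp add: cinner_poly_mapping_def)
qed

end

definition cnorm :: "'a::complex_inner \<Rightarrow> real"
  where "cnorm x = sqrt (Re (cinner x x))"

definition bounded_op :: "('a::complex_inner \<Rightarrow> 'b::complex_inner) \<Rightarrow> bool"
  where "bounded_op T \<longleftrightarrow> Vector_Spaces.linear scaleC scaleC T \<and>
    (\<exists>K. \<forall>x. cnorm (T x) \<le> K * cnorm x)"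

definition invertible_op :: "('a::complex_inner \<Rightarrow> 'a) \<Rightarrow> bool"
  where "invertible_op T \<longleftrightarrow> (\<exists>S. bounded_op S \<and> S \<circ> T = id \<and> T \<circ> S = id)"

definition cadjoint :: "('a::complex_inner \<Rightarrow> 'b::complex_inner) \<Rightarrow> 'b \<Rightarrow> 'a"
  where "cadjoint T y = (THE z. \<forall>x. cinner (T x) y = cinner x z)"

definition orth_proj :: "'a::complex_inner set \<Rightarrow> 'a \<Rightarrow> 'a"
  where "orth_proj S x = (THE y. y \<in> S \<and> (\<forall>z\<in>S. cinner (x - y) z = 0))"

text \<open>
  A finite-dimensional space is a finite-dimensional subspace \<open>E\<close> of an ambient type; operators
  on \<open>E\<close> are functions on the type of which only the values on \<open>E\<close> matter.
\<close>

definition fin_dim_space :: "'a::complex_inner set \<Rightarrow> bool"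
  where "fin_dim_space E \<longleftrightarrow> (\<exists>B. finite B \<and> complex_vector.span B = E)"

definition operator_on :: "'a::complex_inner set \<Rightarrow> ('a \<Rightarrow> 'a) \<Rightarrow> bool"
  where "operator_on E T \<longleftrightarrow> (\<forall>x\<in>E. T x \<in> E) \<and>
    (\<forall>x\<in>E. \<forall>y\<in>E. T (x + y) = T x + T y) \<and> (\<forall>c. \<forall>x\<in>E. T (c *\<^sub>C x) = c *\<^sub>C T x)"

definition selfadjoint_on :: "'a::complex_inner set \<Rightarrow> ('a \<Rightarrow> 'a) \<Rightarrow> bool"
  where "selfadjoint_on E T \<longleftrightarrow> operator_on E T \<and>
    (\<forall>x\<in>E. \<forall>y\<in>E. cinner (T x) y = cinner x (T y))"

text \<open>The matrix of an operator on \<open>E\<close> in an arbitrarily chosen ordered basis of \<open>E\<close>.\<close>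

definition some_basis :: "'a::complex_inner set \<Rightarrow> 'a list"
  where "some_basis E = (SOME bs. distinct bs \<and> complex_vector.independent (set bs) \<and>
    complex_vector.span (set bs) = E)"

definition op_matrix :: "'a::complex_inner set \<Rightarrow> ('a \<Rightarrow> 'a) \<Rightarrow> complex mat"
  where "op_matrix E T = (let bs = some_basis E in
    mat (length bs) (length bs)
      (\<lambda>(i, j). complex_vector.representation (set bs) (T (bs ! j)) (bs ! i)))"

definition op_det :: "'a::complex_inner set \<Rightarrow> ('a \<Rightarrow> 'a) \<Rightarrow> complex"
  where "op_det E T = det (op_matrix E T)"


section \<open>Polynomials in two and three variables\<close>

text \<open>
  \<^typ>\<open>complex poly poly\<close> is the ring of polynomials in \<open>y\<^sub>1\<close> (inner variable) and \<open>y\<^sub>2\<close> (outer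
  variable); \<^typ>\<open>complex poly poly poly\<close> is the ring of polynomials in \<open>x\<^sub>0\<close> (innermost), \<open>x\<^sub>1\<close>
  and \<open>x\<^sub>2\<close> (outermost).
\<close>

type_synonym poly2 = "complex poly poly"
type_synonym poly3 = "complex poly poly poly"

definition const2 :: "complex \<Rightarrow> poly2" where "const2 c = [:[:c:]:]"
definition varY1 :: poly2 where "varY1 = [:[:0, 1:]:]"
definition varY2 :: poly2 where "varY2 = [:0, 1:]"

definition const3 :: "complex \<Rightarrow> poly3" where "const3 c = [:[:[:c:]:]:]"
definition varX0 :: poly3 where "varX0 = [:[:[:0, 1:]:]:]"
definition varX1 :: poly3 where "varX1 = [:[:0, 1:]:]"
definition varX2 :: poly3 where "varX2 = [:0, 1:]"

definition eval2 :: "poly2 \<Rightarrow> complex \<Rightarrow> complex \<Rightarrow> complex"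
  where "eval2 p y1 y2 = poly (poly p [:y2:]) y1"

definition eval3 :: "poly3 \<Rightarrow> complex \<Rightarrow> complex \<Rightarrow> complex \<Rightarrow> complex"
  where "eval3 p x0 x1 x2 = poly (poly (poly p [:[:x2:]:]) [:x1:]) x0"

text \<open>\<open>coeff2 p i j\<close> is the coefficient of \<open>y\<^sub>1\<^sup>i y\<^sub>2\<^sup>j\<close>.\<close>

definition coeff2 :: "poly2 \<Rightarrow> nat \<Rightarrow> nat \<Rightarrow> complex"
  where "coeff2 p i j = coeff (coeff p j) i"

definition real_poly2 :: "poly2 \<Rightarrow> bool"
  where "real_poly2 p \<longleftrightarrow> (\<forall>i j. coeff2 p i j \<in> \<real>)"

definition total_degree2 :: "poly2 \<Rightarrow> nat"
  where "total_degree2 p = Max (insert 0 {i + j | i j. coeff2 p i j \<noteq> 0})"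

definition homogenize :: "nat \<Rightarrow> poly2 \<Rightarrow> poly3"
  where "homogenize n p =
    (\<Sum>(i, j)\<in>{(i, j). i + j \<le> n}. const3 (coeff2 p i j) * varX0 ^ (n - (i + j)) * varX1 ^ i * varX2 ^ j)"

definition poly_op :: "poly2 \<Rightarrow> ('h \<Rightarrow> 'h) \<Rightarrow> ('h \<Rightarrow> 'h) \<Rightarrow> 'h \<Rightarrow> 'h::complex_inner"
  where "poly_op p A1 A2 h =
    (\<Sum>j\<le>degree p. \<Sum>i\<le>degree (coeff p j). coeff2 p i j *\<^sub>C (A1 ^^ i) ((A2 ^^ j) h))"


section \<open>Vessels and their discriminant varieties\<close>

record ('h, 'e) vessel =
  op1 :: "'h \<Rightarrow> 'h"
  op2 :: "'h \<Rightarrow> 'h"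
  window :: "'h \<Rightarrow> 'e"
  ext_space :: "'e set"
  sigma1 :: "'e \<Rightarrow> 'e"
  sigma2 :: "'e \<Rightarrow> 'e"
  gamma_in :: "'e \<Rightarrow> 'e"
  gamma_out :: "'e \<Rightarrow> 'e"

definition commutative_vessel :: "('h::chilbert, 'e::complex_inner) vessel \<Rightarrow> bool"
  where "commutative_vessel V \<longleftrightarrow>
    bounded_op (op1 V) \<and> bounded_op (op2 V) \<and> op1 V \<circ> op2 V = op2 V \<circ> op1 V \<and>
    fin_dim_space (ext_space V) \<and>
    bounded_op (window V) \<and> range (window V) \<subseteq> ext_space V \<and>
    selfadjoint_on (ext_space V) (sigma1 V) \<and> selfadjoint_on (ext_space V) (sigma2 V) \<and>
    selfadjoint_on (ext_space V) (gamma_in V) \<and> selfadjoint_on (ext_space V) (gamma_out V) \<and>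
    (\<forall>h. cadjoint (window V) (sigma1 V (window V h)) =
         (1 / \<i>) *\<^sub>C (op1 V h - cadjoint (op1 V) h)) \<and>
    (\<forall>h. cadjoint (window V) (sigma2 V (window V h)) =
         (1 / \<i>) *\<^sub>C (op2 V h - cadjoint (op2 V) h)) \<and>
    (\<forall>h. gamma_in V (window V h) =
         sigma1 V (window V (cadjoint (op2 V) h)) - sigma2 V (window V (cadjoint (op1 V) h))) \<and>
    (\<forall>h. gamma_out V (window V h) =
         sigma1 V (window V (op2 V h)) - sigma2 V (window V (op1 V h))) \<and>
    (\<forall>e\<in>ext_space V. gamma_out V e = gamma_in V e +
         \<i> *\<^sub>C (sigma1 V (window V (cadjoint (window V) (sigma2 V e))) -
                sigma2 V (window V (cadjoint (window V) (sigma1 V e)))))"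

definition disc_poly :: "('h, 'e::complex_inner) vessel \<Rightarrow> poly2"
  where "disc_poly V = det (
      varY1 \<cdot>\<^sub>m map_mat const2 (op_matrix (ext_space V) (sigma2 V))
    - varY2 \<cdot>\<^sub>m map_mat const2 (op_matrix (ext_space V) (sigma1 V))
    + map_mat const2 (op_matrix (ext_space V) (gamma_in V)))"

definition hom_disc_poly :: "('h, 'e::complex_inner) vessel \<Rightarrow> poly3"
  where "hom_disc_poly V = det (
      varX0 \<cdot>\<^sub>m map_mat const3 (op_matrix (ext_space V) (gamma_in V))
    + varX1 \<cdot>\<^sub>m map_mat const3 (op_matrix (ext_space V) (sigma2 V))
    - varX2 \<cdot>\<^sub>m map_mat const3 (op_matrix (ext_space V) (sigma1 V)))"

definition discriminant_variety :: "('h, 'e::complex_inner) vessel \<Rightarrow> (complex \<times> complex) set"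
  where "discriminant_variety V = {(y1, y2).
    op_det (ext_space V) (\<lambda>e. y1 *\<^sub>C sigma2 V e - y2 *\<^sub>C sigma1 V e + gamma_in V e) = 0}"

lemma some_basis:
  assumes "fin_dim_space E"
  shows "distinct (some_basis E)" "complex_vector.independent (set (some_basis E))"
    "complex_vector.span (set (some_basis E)) = E"
proof -
  from assms obtain B where B: "finite B" "complex_vector.span B = E"
    by (auto simp: fin_dim_space_def)
  obtain B' where B': "B' \<subseteq> B" "complex_vector.independent B'" "B \<subseteq> complex_vector.span B'"
    using complex_vector.maximal_independent_subset[of B] by blast
  have "complex_vector.span B' = E"
    using B' B(2) complex_vector.span_mono complex_vector.span_span by (metis subset_antisym)
  moreover obtain bs where "set bs = B'" "distinct bs"
    using finite_distinct_list[OF finite_subset[OF B'(1) B(1)]] by blast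
  ultimately have "distinct bs \<and> complex_vector.independent (set bs) \<and>
      complex_vector.span (set bs) = E"
    using B' by blast
  then have "distinct (some_basis E) \<and> complex_vector.independent (set (some_basis E)) \<and>
      complex_vector.span (set (some_basis E)) = E"
    unfolding some_basis_def by (rule someI)
  then show "distinct (some_basis E)" "complex_vector.independent (set (some_basis E))"
    "complex_vector.span (set (some_basis E)) = E" by blast+
qed

lemma discriminant_variety_eq_zero_set:
  assumes "commutative_vessel V"
  shows "discriminant_variety V = {(y1, y2). eval2 (disc_poly V) y1 y2 = 0}"
proof -
  let ?E = "ext_space V" and ?bs = "some_basis (ext_space V)"
  have E: "fin_dim_space ?E" and op: "operator_on ?E (sigma1 V)" "operator_on ?E (sigma2 V)"
      "operator_on ?E (gamma_in V)"
    using assms by (auto simp: commutative_vessel_def selfadjoint_on_def)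
  note bs = some_basis[OF E]
  have inE: "T (?bs ! j) \<in> complex_vector.span (set ?bs)"
    if "operator_on ?E T" "j < length ?bs" for T j
    using that bs(3) complex_vector.span_base[OF nth_mem[OF that(2)]]
    by (auto simp: operator_on_def)
  let ?r = "\<lambda>T i j. complex_vector.representation (set ?bs) (T (?bs ! j)) (?bs ! i)"
  have "eval2 (disc_poly V) y1 y2 =
      op_det ?E (\<lambda>e. y1 *\<^sub>C sigma2 V e - y2 *\<^sub>C sigma1 V e + gamma_in V e)" for y1 y2
  proof -
    interpret h: comm_ring_hom "\<lambda>p. eval2 p y1 y2"
      by unfold_locales (simp_all add: eval2_def)
    let ?T = "\<lambda>e. y1 *\<^sub>C sigma2 V e - y2 *\<^sub>C sigma1 V e + gamma_in V e"
    let ?M = "varY1 \<cdot>\<^sub>m map_mat const2 (op_matrix ?E (sigma2 V))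
      - varY2 \<cdot>\<^sub>m map_mat const2 (op_matrix ?E (sigma1 V))
      + map_mat const2 (op_matrix ?E (gamma_in V))"
    have r: "?r ?T i j = y1 * ?r (sigma2 V) i j - y2 * ?r (sigma1 V) i j + ?r (gamma_in V) i j"
      if "j < length ?bs" for i j
    proof -
      note in_span = inE[OF op(1) that] inE[OF op(2) that] inE[OF op(3) that]
      note in_span' = complex_vector.span_scale[OF in_span(2), of y1]
        complex_vector.span_scale[OF in_span(1), of y2]
      show ?thesis
        by (simp only: complex_vector.representation_add
              [OF bs(2) in_span(3) complex_vector.span_diff[OF in_span']]
            complex_vector.representation_diff[OF bs(2) in_span'(2) in_span'(1)]
            complex_vector.representation_scale[OF bs(2) in_span(1)]
            complex_vector.representation_scale[OF bs(2) in_span(2)])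
    qed
    have e: "eval2 varY1 y1 y2 = y1" "eval2 varY2 y1 y2 = y2" "eval2 (const2 c) y1 y2 = c" for c
      by (simp_all add: eval2_def varY1_def varY2_def const2_def)
    have dim: "op_matrix ?E T \<in> carrier_mat (length ?bs) (length ?bs)" for T
      by (simp add: op_matrix_def Let_def)
    have idx: "op_matrix ?E T $$ (i, j) = ?r T i j" if "i < length ?bs" "j < length ?bs" for T i j
      using that by (simp add: op_matrix_def Let_def)
    have "map_mat (\<lambda>p. eval2 p y1 y2) ?M = op_matrix ?E ?T"
    proof (rule eq_matI)
      fix i j assume "i < dim_row (op_matrix ?E ?T)" "j < dim_col (op_matrix ?E ?T)"
      then have ij: "i < length ?bs" "j < length ?bs"
        using dim[of ?T] by auto
      with dim[of "sigma1 V"] dim[of "sigma2 V"] dim[of "gamma_in V"]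
      have "map_mat (\<lambda>p. eval2 p y1 y2) ?M $$ (i, j) =
          y1 * ?r (sigma2 V) i j - y2 * ?r (sigma1 V) i j + ?r (gamma_in V) i j"
        by (auto simp: idx h.hom_add h.hom_minus h.hom_mult e)
      then show "map_mat (\<lambda>p. eval2 p y1 y2) ?M $$ (i, j) = op_matrix ?E ?T $$ (i, j)"
        using r[OF ij(2), of i] idx[OF ij, of ?T] by (simp only:)
    qed (use dim[of ?T] dim[of "gamma_in V"] in auto)
    then show ?thesis
      unfolding op_det_def disc_poly_def using h.hom_det[of ?M] by (simp only:)
  qed
  then show ?thesis
    by (simp add: discriminant_variety_def)
qed


section \<open>Birational isomorphisms of plane curves\<close>

definition irreducible_plane_curve :: "(complex \<times> complex) set \<Rightarrow> bool"
  where "irreducible_plane_curve C \<longleftrightarrow>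
    (\<exists>f :: poly2. irreducible f \<and> C = {(y1, y2). eval2 f y1 y2 = 0})"

text \<open>
  A rational mapping between irreducible plane curves is given in affine coordinates by
  \<open>(p\<^sub>1/p\<^sub>0, p\<^sub>2/p\<^sub>0)\<close>, with \<open>p\<^sub>0\<close> not vanishing identically on the source.
\<close>

definition rat_map :: "poly2 \<Rightarrow> poly2 \<Rightarrow> poly2 \<Rightarrow> complex \<times> complex \<Rightarrow> complex \<times> complex"
  where "rat_map p0 p1 p2 = (\<lambda>(y1, y2).
    (eval2 p1 y1 y2 / eval2 p0 y1 y2, eval2 p2 y1 y2 / eval2 p0 y1 y2))"

definition rat_dom :: "(complex \<times> complex) set \<Rightarrow> poly2 \<Rightarrow> (complex \<times> complex) set"
  where "rat_dom C p0 = {(y1, y2) \<in> C. eval2 p0 y1 y2 \<noteq> 0}"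

definition rational_mapping ::
  "(complex \<times> complex) set \<Rightarrow> (complex \<times> complex) set \<Rightarrow> poly2 \<Rightarrow> poly2 \<Rightarrow> poly2 \<Rightarrow> bool"
  where "rational_mapping C C' p0 p1 p2 \<longleftrightarrow>
    rat_dom C p0 \<noteq> {} \<and> rat_map p0 p1 p2 ` rat_dom C p0 \<subseteq> C'"

text \<open>
  \<open>s\<close> is a left inverse of \<open>r\<close>: the composition \<open>s \<circ> r\<close> is defined as a rational mapping (its
  domain is not empty) and it is the identity wherever it is defined.
\<close>

definition rational_left_inverse ::
  "(complex \<times> complex) set \<Rightarrow> (complex \<times> complex) set \<Rightarrow>
    poly2 \<Rightarrow> poly2 \<Rightarrow> poly2 \<Rightarrow> poly2 \<Rightarrow> poly2 \<Rightarrow> poly2 \<Rightarrow> bool"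
  where "rational_left_inverse C C' p0 p1 p2 q0 q1 q2 \<longleftrightarrow>
    {x \<in> rat_dom C p0. rat_map p0 p1 p2 x \<in> rat_dom C' q0} \<noteq> {} \<and>
    (\<forall>x \<in> rat_dom C p0. rat_map p0 p1 p2 x \<in> rat_dom C' q0 \<longrightarrow>
      rat_map q0 q1 q2 (rat_map p0 p1 p2 x) = x)"

definition birational_isomorphism ::
  "(complex \<times> complex) set \<Rightarrow> (complex \<times> complex) set \<Rightarrow> poly2 \<Rightarrow> poly2 \<Rightarrow> poly2 \<Rightarrow> bool"
  where "birational_isomorphism C C' p0 p1 p2 \<longleftrightarrow> rational_mapping C C' p0 p1 p2 \<and>
    (\<exists>q0 q1 q2. rational_mapping C' C q0 q1 q2 \<and>
      rational_left_inverse C C' p0 p1 p2 q0 q1 q2 \<and>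
      rational_left_inverse C' C q0 q1 q2 p0 p1 p2)"


section \<open>The transformed vessel\<close>

text \<open>
  The multi-index \<open>(i\<^sub>0, i\<^sub>1, i\<^sub>2)\<close> with \<open>i\<^sub>0 + i\<^sub>1 + i\<^sub>2 = n - 1\<close> is encoded as \<open>(i\<^sub>1, i\<^sub>2)\<close>.  For
  \<open>n = 0\<close> there is none.
\<close>

type_synonym mindex = "nat \<times> nat"

definition mindices :: "nat \<Rightarrow> mindex set"
  where "mindices n = {(i1, i2). i1 + i2 < n}"

definition monom3 :: "nat \<Rightarrow> mindex \<Rightarrow> complex \<Rightarrow> complex \<Rightarrow> complex \<Rightarrow> complex"
  where "monom3 n i x0 x1 x2 = x0 ^ (n - 1 - fst i - snd i) * x1 ^ fst i * x2 ^ snd i"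

type_synonym bmatrix = "mindex \<Rightarrow> mindex \<Rightarrow> complex"

text \<open>The three matrices are listed in the order \<open>\<beta>\<^sup>1\<^sup>0, \<beta>\<^sup>2\<^sup>0, \<beta>\<^sup>1\<^sup>2\<close>.\<close>

definition bezout_matrices :: "nat \<Rightarrow> poly3 \<Rightarrow> poly3 \<Rightarrow> bmatrix \<times> bmatrix \<times> bmatrix \<Rightarrow> bool"
  where "bezout_matrices n p q = (\<lambda>(b10, b20, b12).
    (\<forall>i\<in>mindices n. \<forall>j\<in>mindices n.
      b10 i j = b10 j i \<and> b20 i j = b20 j i \<and> b12 i j = b12 j i) \<and>
    (\<forall>x0 x1 x2 y0 y1 y2.
      eval3 p x0 x1 x2 * eval3 q y0 y1 y2 - eval3 q x0 x1 x2 * eval3 p y0 y1 y2 =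
      (\<Sum>i\<in>mindices n. \<Sum>j\<in>mindices n.
          b10 i j * monom3 n i x0 x1 x2 * (x1 * y0 - x0 * y1) * monom3 n j y0 y1 y2
        + b20 i j * monom3 n i x0 x1 x2 * (x2 * y0 - x0 * y2) * monom3 n j y0 y1 y2
        + b12 i j * monom3 n i x0 x1 x2 * (x1 * y2 - x2 * y1) * monom3 n j y0 y1 y2)))"

definition family :: "nat \<Rightarrow> (mindex \<Rightarrow> 'e) \<Rightarrow> (mindex \<Rightarrow>\<^sub>0 'e::complex_inner)"
  where "family n f = (\<Sum>i\<in>mindices n. Poly_Mapping.single i (f i))"

definition principal_subspace ::
  "nat \<Rightarrow> ('h, 'e::complex_inner) vessel \<Rightarrow> (mindex \<Rightarrow>\<^sub>0 'e) set"
  where "principal_subspace n V = {w.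
    Poly_Mapping.keys w \<subseteq> mindices n \<and> (\<forall>i. Poly_Mapping.lookup w i \<in> ext_space V) \<and>
    (\<forall>i1 i2. Suc (i1 + i2) < n \<longrightarrow>
      sigma2 V (Poly_Mapping.lookup w (Suc i1, i2))
      - sigma1 V (Poly_Mapping.lookup w (i1, Suc i2))
      + gamma_in V (Poly_Mapping.lookup w (i1, i2)) = 0)}"

definition bezout_op :: "nat \<Rightarrow> ('h, 'e::complex_inner) vessel \<Rightarrow> bmatrix \<times> bmatrix \<times> bmatrix \<Rightarrow>
    (mindex \<Rightarrow>\<^sub>0 'e) \<Rightarrow> (mindex \<Rightarrow>\<^sub>0 'e)"
  where "bezout_op n V = (\<lambda>(b10, b20, b12) w. family n (\<lambda>i. \<Sum>j\<in>mindices n.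
      b12 i j *\<^sub>C gamma_in V (Poly_Mapping.lookup w j)
    + b10 i j *\<^sub>C sigma1 V (Poly_Mapping.lookup w j)
    + b20 i j *\<^sub>C sigma2 V (Poly_Mapping.lookup w j)))"

definition compressed_bezout_op ::
  "nat \<Rightarrow> ('h, 'e::complex_inner) vessel \<Rightarrow> bmatrix \<times> bmatrix \<times> bmatrix \<Rightarrow>
    (mindex \<Rightarrow>\<^sub>0 'e) \<Rightarrow> (mindex \<Rightarrow>\<^sub>0 'e)"
  where "compressed_bezout_op n V b w =
    orth_proj (principal_subspace n V) (bezout_op n V b (orth_proj (principal_subspace n V) w))"

text \<open>
  The arguments \<open>b1\<close>, \<open>b2\<close>, \<open>b3\<close> are to be Bezout matrices of \<open>(P\<^sub>1, P\<^sub>0)\<close>, \<open>(P\<^sub>2, P\<^sub>0)\<close> and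
  \<open>(P\<^sub>1, P\<^sub>2)\<close>.  Bezout matrices are not unique, so they are arguments; the operators they induce
  on the principal subspace do not depend on the choice.
\<close>

definition transformed_vessel ::
  "('h::chilbert, 'e::complex_inner) vessel \<Rightarrow> nat \<Rightarrow> poly2 \<Rightarrow> poly2 \<Rightarrow> poly2 \<Rightarrow>
    bmatrix \<times> bmatrix \<times> bmatrix \<Rightarrow> bmatrix \<times> bmatrix \<times> bmatrix \<Rightarrow>
    bmatrix \<times> bmatrix \<times> bmatrix \<Rightarrow> ('h, mindex \<Rightarrow>\<^sub>0 'e) vessel"
  where "transformed_vessel V n p0 p1 p2 b1 b2 b3 =
    (let R = inv_into UNIV (poly_op p0 (op1 V) (op2 V));
         A1' = cadjoint (op1 V);
         A2' = cadjoint (op2 V);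
         R' = inv_into UNIV (poly_op p0 A1' A2');
         E' = principal_subspace n V;
         Phi' = (\<lambda>h. orth_proj E' (family n (\<lambda>(i1, i2). window V ((A1' ^^ i1) ((A2' ^^ i2) (R' h))))));
         s1 = compressed_bezout_op n V b1;
         s2 = compressed_bezout_op n V b2;
         g = compressed_bezout_op n V b3
     in \<lparr> op1 = R \<circ> poly_op p1 (op1 V) (op2 V),
          op2 = R \<circ> poly_op p2 (op1 V) (op2 V),
          window = Phi',
          ext_space = E',
          sigma1 = s1,
          sigma2 = s2,
          gamma_in = g,
          gamma_out = (\<lambda>e. g e + \<i> *\<^sub>C (s1 (Phi' (cadjoint Phi' (s2 e))) -
                                          s2 (Phi' (cadjoint Phi' (s1 e))))) \<rparr>)"

end

theory Submission
  imports
    Defs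
    "HOL-Computational_Algebra.Fundamental_Theorem_Algebra"
    "HOL-Computational_Algebra.Field_as_Ring"
begin

text \<open>
  A point \<open>y\<close> of the curve \<open>C\<close> carries a vector \<open>u \<noteq> 0\<close> of \<open>E\<close> with
  \<open>(y\<^sub>1 \<sigma>\<^sub>2 - y\<^sub>2 \<sigma>\<^sub>1 + \<gamma>) u = 0\<close>, and the family \<open>w = (y\<^sup>i u)\<^sub>i\<close> of its multiples by the monomials
  of degree less than \<open>n\<close> lies in the principal subspace.  The proof shows that \<open>w\<close> is in the
  kernel of the pencil of the transformed vessel at the image point \<open>t = r(y)\<close>, so that \<open>t\<close> is on
  the new discriminant variety.

  To see this, fix \<open>z\<close> in the principal subspace and regard \<open>L\<^sub>k(x\<^sup>i) = \<langle>\<sigma>\<^sub>k u, z\<^sub>i\<rangle>\<close> as linear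
  functionals on polynomials in \<open>x\<close> of degree less than \<open>n\<close>.  The equation for \<open>u\<close> expresses
  \<open>\<langle>\<gamma> u, z\<^sub>i\<rangle>\<close> through \<open>L\<^sub>1\<close> and \<open>L\<^sub>2\<close>, and the pairing of \<open>z\<close> with the image of \<open>w\<close> under the pencil
  becomes \<open>L\<^sub>1(a\<^sub>1) + L\<^sub>2(a\<^sub>2)\<close>, where \<open>a\<^sub>1(x) (x\<^sub>1 - y\<^sub>1) + a\<^sub>2(x) (x\<^sub>2 - y\<^sub>2)\<close> is a combination of the
  three Bezoutians \<open>p(x) q(y) - q(x) p(y)\<close>.  At \<open>t = r(y)\<close> that combination is, up to a factor,
  a three by three determinant with two equal rows, hence zero for all \<open>x\<close>.  On the other side,
  the equations of the principal subspace for \<open>z\<close> say that \<open>L\<^sub>2((x\<^sub>1 - y\<^sub>1) f) = L\<^sub>1((x\<^sub>2 - y\<^sub>2) f)\<close>,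
  and therefore both functionals come from a single functional \<open>m\<close> by
  \<open>L\<^sub>k(f) = m((x\<^sub>k - y\<^sub>k) f)\<close> (\<open>recurrence_potential\<close>).  So the pairing is \<open>m(0) = 0\<close>
  (\<open>koszul_pairing_eq_0\<close>, \<open>pencil_annihilates_point_vector\<close>).

  The determinant of the new pencil is thus a polynomial that vanishes on the image of \<open>r\<close>.
  The image misses at most the points of \<open>C'\<close> at which a certain polynomial not divisible by the
  irreducible equation \<open>g\<close> of \<open>C'\<close> vanishes: those at which the inverse of \<open>r\<close> is undefined or
  takes values outside the domain of \<open>r\<close>.  By the Nullstellensatz for a principal prime ideal
  (\<open>irreducible_dvd_if_vanishes\<close>), \<open>g\<close> divides the determinant (\<open>birational_image_dense\<close>), which
  therefore vanishes on all of \<open>C'\<close>.  For \<open>n = 0\<close> the principal subspace would be zero and the new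
  variety empty, but then \<open>r\<close> would be constant, which is impossible for a birational isomorphism
  (\<open>birational_isomorphism_degree_pos\<close>).
\<close>

section \<open>Orthogonal projections onto finite-dimensional subspaces\<close>

lemma cinner_add_right: "cinner x (y + z) = cinner x y + cinner x z"
  by (metis cinner_add_left cinner_commute complex_cnj_add)

lemma cinner_scaleC_right: "cinner x (c *\<^sub>C y) = cnj c * cinner x y"
  by (metis cinner_commute cinner_scaleC_left complex_cnj_mult)

lemma cinner_diff_left: "cinner (x - y) z = cinner x z - cinner y z"
  by (metis add_diff_cancel_right' cinner_add_left diff_add_cancel)

lemma cinner_zero [simp]: "cinner 0 x = 0" "cinner x 0 = 0"
  using cinner_diff_left[of 0 0 x] cinner_commute[of x 0] by simp_all

lemma cinner_sum_left: "cinner (\<Sum>i\<in>I. f i) z = (\<Sum>i\<in>I. cinner (f i) z)"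
  by (induction I rule: infinite_finite_induct) (simp_all add: cinner_add_left)

lemma fin_dim_space_subspace: "fin_dim_space E \<Longrightarrow> complex_vector.subspace E"
  unfolding fin_dim_space_def by (auto simp: complex_vector.subspace_span)

text \<open>
  A maximal independent subset of the subspace is finite by the exchange lemma.
\<close>

lemma subspace_of_span_fin_dim:
  assumes "complex_vector.subspace S" "finite B" "S \<subseteq> complex_vector.span B"
  shows "fin_dim_space S"
proof -
  obtain A where A: "A \<subseteq> S" "complex_vector.independent A" "S \<subseteq> complex_vector.span A"
    using complex_vector.maximal_independent_subset[of S] by blast
  have "finite A"
    using complex_vector.independent_span_bound[OF assms(2) A(2)] A(1) assms(3) by blast
  moreover have "complex_vector.span A = S"
    using A assms(1) complex_vector.span_minimal by blast
  ultimately show ?thesis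
    by (auto simp: fin_dim_space_def)
qed

text \<open>One step of the Gram-Schmidt process: only the part of the new vector that is orthogonal
  to the span of the others changes the projection.\<close>

lemma orthogonal_projection_exists:
  fixes x :: "'a::complex_inner"
  assumes "finite B"
  shows "\<exists>y\<in>complex_vector.span B. \<forall>z\<in>complex_vector.span B. cinner (x - y) z = 0"
  using assms
proof (induction B arbitrary: x)
  case empty
  show ?case by auto
next
  case (insert b B)
  obtain b0 where b0: "b0 \<in> complex_vector.span B" "\<And>z. z \<in> complex_vector.span B \<Longrightarrow> cinner (b - b0) z = 0"
    using insert.IH by blast
  obtain y0 where y0: "y0 \<in> complex_vector.span B" "\<And>z. z \<in> complex_vector.span B \<Longrightarrow> cinner (x - y0) z = 0"
    using insert.IH by blast
  define e where "e = b - b0"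
  show ?case
  proof (cases "e = 0")
    case True
    then have "b \<in> complex_vector.span B"
      using b0(1) by (simp add: e_def)
    then show ?thesis
      using y0 by (metis complex_vector.span_redundant)
  next
    case False
    define c where "c = cinner (x - y0) e / cinner e e"
    have ee: "cinner e e \<noteq> 0"
      using False by (simp add: cinner_eq_zero_iff)
    have sub: "complex_vector.span B \<subseteq> complex_vector.span (insert b B)"
      by (intro complex_vector.span_mono) auto
    have e_in: "e \<in> complex_vector.span (insert b B)"
      unfolding e_def using b0(1) sub
      by (intro complex_vector.span_diff) (auto intro: complex_vector.span_base)
    have "cinner (x - (y0 + c *\<^sub>C e)) z = 0" if z: "z \<in> complex_vector.span (insert b B)" for z
    proof -
      obtain k where k: "z - k *\<^sub>C b \<in> complex_vector.span B"
        using z by (auto simp: complex_vector.span_breakdown_eq)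
      define z1 where "z1 = (z - k *\<^sub>C b) + k *\<^sub>C b0"
      have z1: "z1 \<in> complex_vector.span B"
        unfolding z1_def by (intro complex_vector.span_add complex_vector.span_scale k b0)
      have "z = k *\<^sub>C e + z1"
        by (simp add: z1_def e_def complex_vector.scale_right_diff_distrib)
      moreover have "x - (y0 + c *\<^sub>C e) = (x - y0) - c *\<^sub>C e"
        by simp
      ultimately show ?thesis
        using b0(2)[OF z1] y0(2)[OF z1] ee
        by (simp only: cinner_add_right cinner_diff_left[of "x - y0"] cinner_scaleC_left
            cinner_scaleC_right) (simp add: e_def[symmetric] c_def)
    qed
    moreover have "y0 + c *\<^sub>C e \<in> complex_vector.span (insert b B)"
      using y0(1) sub e_in by (blast intro: complex_vector.span_add complex_vector.span_scale)
    ultimately show ?thesis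
      by blast
  qed
qed

lemma orth_proj_eqI:
  assumes S: "complex_vector.subspace S" and "y \<in> S" "\<And>z. z \<in> S \<Longrightarrow> cinner (x - y) z = 0"
  shows "orth_proj S x = y"
  unfolding orth_proj_def
proof (rule the_equality)
  fix y' assume y': "y' \<in> S \<and> (\<forall>z\<in>S. cinner (x - y') z = 0)"
  define d where "d = y' - y"
  have "d \<in> S"
    using S assms(2) y' by (auto simp: d_def complex_vector.subspace_diff)
  then have "cinner (x - y) d - cinner (x - y') d = 0"
    using assms(3) y' by simp
  then have "cinner d d = 0"
    by (simp add: d_def flip: cinner_diff_left)
  then show "y' = y"
    by (simp add: cinner_eq_zero_iff d_def)
qed (use assms in blast)

lemma orth_proj:
  assumes "fin_dim_space S"
  shows "orth_proj S x \<in> S" and "z \<in> S \<Longrightarrow> cinner (x - orth_proj S x) z = 0"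
proof -
  obtain B where "finite B" "complex_vector.span B = S"
    using assms by (auto simp: fin_dim_space_def)
  then obtain y where y: "y \<in> S" "\<And>z. z \<in> S \<Longrightarrow> cinner (x - y) z = 0"
    using orthogonal_projection_exists[of B x] by blast
  then have "orth_proj S x = y"
    by (intro orth_proj_eqI fin_dim_space_subspace assms)
  with y show "orth_proj S x \<in> S" "z \<in> S \<Longrightarrow> cinner (x - orth_proj S x) z = 0"
    by auto
qed

lemma orth_proj_of_mem: "fin_dim_space S \<Longrightarrow> x \<in> S \<Longrightarrow> orth_proj S x = x"
  by (intro orth_proj_eqI fin_dim_space_subspace) auto

lemma orth_proj_of_orthogonal:
  assumes "fin_dim_space S" "\<And>z. z \<in> S \<Longrightarrow> cinner x z = 0"
  shows "orth_proj S x = 0"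
  using assms by (intro orth_proj_eqI fin_dim_space_subspace)
    (auto simp: complex_vector.subspace_0 fin_dim_space_subspace)

lemma orth_proj_add:
  assumes "fin_dim_space S"
  shows "orth_proj S (x + y) = orth_proj S x + orth_proj S y"
proof (rule orth_proj_eqI)
  show "complex_vector.subspace S"
    using assms by (rule fin_dim_space_subspace)
  then show "orth_proj S x + orth_proj S y \<in> S"
    using orth_proj(1)[OF assms] by (auto intro: complex_vector.subspace_add)
  fix z assume "z \<in> S"
  moreover have "x + y - (orth_proj S x + orth_proj S y) = (x - orth_proj S x) + (y - orth_proj S y)"
    by simp
  ultimately show "cinner (x + y - (orth_proj S x + orth_proj S y)) z = 0"
    using orth_proj(2)[OF assms] by (simp only: cinner_add_left) simp
qed

lemma orth_proj_scaleC:
  assumes "fin_dim_space S"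
  shows "orth_proj S (c *\<^sub>C x) = c *\<^sub>C orth_proj S x"
proof (rule orth_proj_eqI)
  show "complex_vector.subspace S"
    using assms by (rule fin_dim_space_subspace)
  then show "c *\<^sub>C orth_proj S x \<in> S"
    using orth_proj(1)[OF assms] by (auto intro: complex_vector.subspace_scale)
  fix z assume "z \<in> S"
  then show "cinner (c *\<^sub>C x - c *\<^sub>C orth_proj S x) z = 0"
    using orth_proj(2)[OF assms]
    by (simp add: cinner_scaleC_left flip: complex_vector.scale_right_diff_distrib)
qed

lemma orth_proj_diff:
  assumes "fin_dim_space S"
  shows "orth_proj S (x - y) = orth_proj S x - orth_proj S y"
  using orth_proj_add[OF assms, of "x - y" y] by simp


section \<open>Determinants of operators on finite-dimensional spaces\<close>

lemma operator_on_sum: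
  assumes T: "operator_on E T" and E: "complex_vector.subspace E"
    and f: "\<And>i. i \<in> I \<Longrightarrow> f i \<in> E"
  shows "T (\<Sum>i\<in>I. c i *\<^sub>C f i) = (\<Sum>i\<in>I. c i *\<^sub>C T (f i))"
proof -
  have T0: "T 0 = 0"
    using T complex_vector.subspace_0[OF E] complex_vector.scale_zero_left
    by (metis operator_on_def)
  show ?thesis
    using f
  proof (induction I rule: infinite_finite_induct)
    case (insert i I)
    have "(\<Sum>i\<in>I. c i *\<^sub>C f i) \<in> E" "c i *\<^sub>C f i \<in> E"
      using insert.prems E
      by (auto intro!: complex_vector.subspace_sum complex_vector.subspace_scale)
    then show ?case
      using insert T by (simp add: operator_on_def)
  qed (simp_all add: T0)
qed

definition coords :: "'a::complex_inner set \<Rightarrow> 'a \<Rightarrow> complex vec"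
  where "coords E u = vec (length (some_basis E))
    (\<lambda>i. complex_vector.representation (set (some_basis E)) u (some_basis E ! i))"

lemma op_matrix_carrier:
  "op_matrix E T \<in> carrier_mat (length (some_basis E)) (length (some_basis E))"
  by (simp add: op_matrix_def Let_def)

lemma sum_some_basis:
  assumes "fin_dim_space E"
  shows "(\<Sum>b\<in>set (some_basis E). f b) = (\<Sum>j<length (some_basis E). f (some_basis E ! j))"
  using sum.reindex_bij_betw[OF bij_betw_nth[OF some_basis(1)[OF assms] refl refl], of f] by simp

lemma expand_in_some_basis:
  assumes "fin_dim_space E" "u \<in> E"
  shows "(\<Sum>j<length (some_basis E). (coords E u $ j) *\<^sub>C (some_basis E ! j)) = u"
proof -
  note bs = some_basis[OF assms(1)]
  have "(\<Sum>b\<in>set (some_basis E).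
      complex_vector.representation (set (some_basis E)) u b *\<^sub>C b) = u"
    using bs assms(2) by (intro complex_vector.sum_representation_eq) auto
  then show ?thesis
    by (simp add: sum_some_basis[OF assms(1)] coords_def)
qed

lemma op_matrix_mult_coords:
  assumes E: "fin_dim_space E" and T: "operator_on E T" and u: "u \<in> E"
  shows "op_matrix E T *\<^sub>v coords E u = coords E (T u)"
proof (rule eq_vecI)
  let ?bs = "some_basis E"
  note bs = some_basis[OF E]
  have mem: "?bs ! j \<in> E" if "j < length ?bs" for j
    using that bs(3) complex_vector.span_base nth_mem by blast
  fix i assume "i < dim_vec (coords E (T u))"
  then have i: "i < length ?bs"
    by (simp add: coords_def)
  have Tin: "T (?bs ! j) \<in> complex_vector.span (set ?bs)" if "j < length ?bs" for j
    using T mem[OF that] bs(3) by (auto simp: operator_on_def)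
  have "T u = T (\<Sum>j<length ?bs. (coords E u $ j) *\<^sub>C (?bs ! j))"
    using expand_in_some_basis[OF E u] by simp
  also have "\<dots> = (\<Sum>j<length ?bs. (coords E u $ j) *\<^sub>C T (?bs ! j))"
    using mem by (intro operator_on_sum[OF T fin_dim_space_subspace[OF E]]) auto
  finally have Tu: "T u = (\<Sum>j<length ?bs. (coords E u $ j) *\<^sub>C T (?bs ! j))" .
  have "complex_vector.representation (set ?bs) (T u) (?bs ! i) =
      (\<Sum>j<length ?bs. complex_vector.representation (set ?bs)
        ((coords E u $ j) *\<^sub>C T (?bs ! j)) (?bs ! i))"
    unfolding Tu using Tin bs(2)
    by (subst complex_vector.representation_sum) (auto intro: complex_vector.span_scale)
  also have "\<dots> = (\<Sum>j<length ?bs. (coords E u $ j) *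
      complex_vector.representation (set ?bs) (T (?bs ! j)) (?bs ! i))"
    using Tin bs(2) by (intro sum.cong) (simp_all add: complex_vector.representation_scale)
  finally show "(op_matrix E T *\<^sub>v coords E u) $ i = coords E (T u) $ i"
    using i by (simp add: op_matrix_def Let_def coords_def scalar_prod_def row_def
        lessThan_atLeast0 mult.commute)
qed (simp add: op_matrix_def coords_def Let_def)

text \<open>
  In coordinates with respect to the chosen basis this is the criterion for a singular matrix;
  it does not depend on which basis was chosen.
\<close>

lemma op_det_eq_0_iff:
  assumes E: "fin_dim_space E" and T: "operator_on E T"
  shows "op_det E T = 0 \<longleftrightarrow> (\<exists>u\<in>E. u \<noteq> 0 \<and> T u = 0)"
proof -
  let ?bs = "some_basis E"
  note bs = some_basis[OF E]
  note sub = fin_dim_space_subspace[OF E]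
  have zero: "coords E u = 0\<^sub>v (length ?bs) \<longleftrightarrow> u = 0" if "u \<in> E" for u
  proof
    assume "coords E u = 0\<^sub>v (length ?bs)"
    then show "u = 0"
      using expand_in_some_basis[OF E that] by simp
  next
    assume "u = 0"
    then show "coords E u = 0\<^sub>v (length ?bs)"
      by (auto simp: coords_def complex_vector.representation_zero)
  qed
  have surj: "\<exists>u\<in>E. coords E u = v" if v: "v \<in> carrier_vec (length ?bs)" for v
  proof
    have mem: "?bs ! j \<in> complex_vector.span (set ?bs)" if "j < length ?bs" for j
      using that by (intro complex_vector.span_base) auto
    let ?u = "\<Sum>j<length ?bs. (v $ j) *\<^sub>C (?bs ! j)"
    have "?u \<in> complex_vector.span (set ?bs)"
      using mem by (auto intro!: complex_vector.span_sum complex_vector.span_scale)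
    then show "?u \<in> E"
      by (simp only: bs(3))
    show "coords E ?u = v"
    proof (rule eq_vecI)
      fix i assume "i < dim_vec v"
      then have i: "i < length ?bs" using v by auto
      have "complex_vector.representation (set ?bs) ?u (?bs ! i) =
          (\<Sum>j<length ?bs. complex_vector.representation (set ?bs)
            ((v $ j) *\<^sub>C (?bs ! j)) (?bs ! i))"
        using mem bs(2)
        by (subst complex_vector.representation_sum) (auto intro: complex_vector.span_scale)
      also have "\<dots> = (\<Sum>j<length ?bs. if i = j then v $ j else 0)"
        using mem bs(1,2) i
        by (intro sum.cong) (auto simp: complex_vector.representation_scale
            complex_vector.representation_basis nth_eq_iff_index_eq)
      finally show "coords E ?u $ i = v $ i"
        using i by (simp add: coords_def)
    qed (use v in \<open>auto simp: coords_def\<close>)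
  qed
  have Tin: "T u \<in> E" if "u \<in> E" for u
    using T that by (auto simp: operator_on_def)
  have "op_det E T = 0 \<longleftrightarrow> (\<exists>v. v \<in> carrier_vec (length ?bs) \<and> v \<noteq> 0\<^sub>v (length ?bs) \<and>
      op_matrix E T *\<^sub>v v = 0\<^sub>v (length ?bs))"
    unfolding op_det_def by (rule det_0_iff_vec_prod_zero[OF op_matrix_carrier])
  also have "\<dots> \<longleftrightarrow> (\<exists>u\<in>E. coords E u \<noteq> 0\<^sub>v (length ?bs) \<and>
      op_matrix E T *\<^sub>v coords E u = 0\<^sub>v (length ?bs))"
  proof
    assume "\<exists>u\<in>E. coords E u \<noteq> 0\<^sub>v (length ?bs) \<and>
      op_matrix E T *\<^sub>v coords E u = 0\<^sub>v (length ?bs)"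
    moreover have "coords E u \<in> carrier_vec (length ?bs)" for u
      by (simp add: coords_def)
    ultimately show "\<exists>v. v \<in> carrier_vec (length ?bs) \<and> v \<noteq> 0\<^sub>v (length ?bs) \<and>
        op_matrix E T *\<^sub>v v = 0\<^sub>v (length ?bs)"
      by blast
  qed (use surj in metis)
  also have "\<dots> \<longleftrightarrow> (\<exists>u\<in>E. u \<noteq> 0 \<and> T u = 0)"
    by (intro bex_cong refl) (simp add: op_matrix_mult_coords[OF E T] zero Tin)
  finally show ?thesis .
qed

lemma eval2_simps [simp]:
  "eval2 0 y1 y2 = 0" "eval2 1 y1 y2 = 1"
  "eval2 (p + q) y1 y2 = eval2 p y1 y2 + eval2 q y1 y2"
  "eval2 (p - q) y1 y2 = eval2 p y1 y2 - eval2 q y1 y2"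
  "eval2 (p * q) y1 y2 = eval2 p y1 y2 * eval2 q y1 y2"
  "eval2 (p ^ k) y1 y2 = eval2 p y1 y2 ^ k"
  "eval2 (sum f I) y1 y2 = (\<Sum>i\<in>I. eval2 (f i) y1 y2)"
  "eval2 (const2 c) y1 y2 = c" "eval2 varY1 y1 y2 = y1" "eval2 varY2 y1 y2 = y2"
  by (simp_all add: eval2_def const2_def varY1_def varY2_def poly_sum)

lemma pencil_det_is_polynomial:
  assumes E: "fin_dim_space E"
    and op: "operator_on E S2" "operator_on E S1" "operator_on E G"
  shows "\<exists>f. \<forall>y1 y2. eval2 f y1 y2 = op_det E (\<lambda>e. y1 *\<^sub>C S2 e - y2 *\<^sub>C S1 e + G e)"
proof -
  let ?bs = "some_basis E"
  note bs = some_basis[OF E]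
  define M where "M = mat (length ?bs) (length ?bs) (\<lambda>ij.
    varY1 * const2 (op_matrix E S2 $$ ij) - varY2 * const2 (op_matrix E S1 $$ ij)
      + const2 (op_matrix E G $$ ij))"
  have "eval2 (det M) y1 y2 = op_det E (\<lambda>e. y1 *\<^sub>C S2 e - y2 *\<^sub>C S1 e + G e)" for y1 y2
  proof -
    interpret h: comm_ring_hom "\<lambda>p. eval2 p y1 y2"
      by unfold_locales simp_all
    have "map_mat (\<lambda>p. eval2 p y1 y2) M = op_matrix E (\<lambda>e. y1 *\<^sub>C S2 e - y2 *\<^sub>C S1 e + G e)"
      (is "_ = op_matrix E ?T")
    proof (rule eq_matI)
      fix i j assume "i < dim_row (op_matrix E ?T)" "j < dim_col (op_matrix E ?T)"
      then have ij: "i < length ?bs" "j < length ?bs"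
        using op_matrix_carrier[of E ?T] by auto
      have "?bs ! j \<in> E"
        using ij bs(3) complex_vector.span_base nth_mem by blast
      then have "S2 (?bs ! j) \<in> complex_vector.span (set ?bs)"
          "S1 (?bs ! j) \<in> complex_vector.span (set ?bs)"
          "G (?bs ! j) \<in> complex_vector.span (set ?bs)"
        using op bs(3) by (auto simp: operator_on_def)
      then show "map_mat (\<lambda>p. eval2 p y1 y2) M $$ (i, j) = op_matrix E ?T $$ (i, j)"
        using ij bs(2)
        by (simp add: M_def op_matrix_def Let_def complex_vector.representation_add
            complex_vector.representation_diff complex_vector.representation_scale
            complex_vector.span_scale complex_vector.span_diff)
    qed (simp_all add: M_def op_matrix_def Let_def)
    then show ?thesis
      unfolding op_det_def by (metis h.hom_det)
  qed
  then show ?thesis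
    by blast
qed


section \<open>Polynomials vanishing on an irreducible plane curve\<close>

lemma eval2_pCons: "eval2 (pCons c p) y1 y2 = poly c y1 + y2 * eval2 p y1 y2"
  by (simp add: eval2_def)

lemma eval2_conv_map_poly: "eval2 p y1 y2 = poly (map_poly (\<lambda>c. poly c y1) p) y2"
proof (induction p)
  case (pCons c p)
  then show ?case
    by (simp add: eval2_pCons map_poly_pCons)
qed simp

text \<open>
  The constants provide infinitely many roots in the coefficient ring of the outer variable.
\<close>

lemma eval2_eq_0_imp_eq_0:
  assumes "\<And>y1 y2. eval2 p y1 y2 = 0"
  shows "p = 0"
proof (rule ccontr)
  assume "p \<noteq> 0"
  have "poly p [:y2:] = 0" for y2
    using assms poly_all_0_iff_0[of "poly p [:y2:]"] by (simp add: eval2_def)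
  then have "range (\<lambda>c::complex. [:c:]) \<subseteq> {x. poly p x = 0}"
    by auto
  moreover have "infinite (range (\<lambda>c::complex. [:c:]))"
    using finite_imageD[of "\<lambda>c. [:c:]" "UNIV :: complex set"] infinite_UNIV_char_0[where 'a = complex]
    by (auto simp: inj_on_def)
  ultimately show False
    using poly_roots_finite[OF \<open>p \<noteq> 0\<close>] finite_subset by blast
qed

text \<open>
  The Nullstellensatz for a principal prime ideal in two variables.  If \<open>g\<close> contains only
  \<open>y\<^sub>1\<close>, it is a line \<open>y\<^sub>1 = a\<close> up to a unit.  Otherwise a nonzero element of the ideal \<open>(g, h)\<close> of
  least degree in \<open>y\<^sub>2\<close> divides, up to factors in \<open>y\<^sub>1\<close>, both \<open>g\<close> and \<open>h\<close>.  If \<open>g\<close> did not divide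
  \<open>h\<close>, that element would be a polynomial in \<open>y\<^sub>1\<close> alone; but almost every line \<open>y\<^sub>1 = const\<close> meets
  the curve, and every element of the ideal vanishes there.
\<close>

lemma irreducible_dvd_if_vanishes:
  fixes g h :: poly2
  assumes g: "irreducible g" and van: "\<And>y1 y2. eval2 g y1 y2 = 0 \<Longrightarrow> eval2 h y1 y2 = 0"
  shows "g dvd h"
proof (cases "degree g = 0")
  case True
  then obtain g0 where g0: "g = [:g0:]"
    by (rule degree_eq_zeroE)
  have "degree g0 > 0"
  proof (rule ccontr)
    assume "\<not> degree g0 > 0"
    then have "degree g0 = 0"
      by simp
    then obtain c where "g0 = [:c:]"
      by (rule degree_eq_zeroE)
    with g g0 show False
      by (auto simp: irreducible_def is_unit_const_poly_iff is_unit_poly_iff dvd_field_iff)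
  qed
  then obtain a where a: "poly g0 a = 0"
    using alg_closed_imp_poly_has_root by blast
  have "[:[:-a, 1:]:] dvd g"
    using a by (simp add: g0 poly_eq_0_iff_dvd)
  moreover have "\<not> [:[:-a, 1:]:] dvd 1"
    by (simp add: is_unit_const_poly_iff is_unit_poly_iff)
  ultimately have "g dvd [:[:-a, 1:]:]"
    using irreducibleD'[OF g] by blast
  moreover have "[:[:-a, 1:]:] dvd h"
  proof -
    have "poly (map_poly (\<lambda>c. poly c a) h) y2 = 0" for y2
      using van[of a y2] a by (simp add: g0 flip: eval2_conv_map_poly) (simp add: eval2_def)
    then have "map_poly (\<lambda>c. poly c a) h = 0"
      using poly_all_0_iff_0 by blast
    then have "poly (coeff h k) a = 0" for k
      by (metis coeff_0 coeff_map_poly poly_0)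
    then show ?thesis
      by (simp add: const_poly_dvd_iff poly_eq_0_iff_dvd)
  qed
  ultimately show ?thesis
    by (rule dvd_trans)
next
  case False
  have prime: "prime_elem g"
    using g by (rule irreducible_imp_prime_elem)
  have g_ndvd: "\<not> g dvd [:c:]" if "c \<noteq> 0" for c
    using dvd_imp_degree_le[of g "[:c:]"] False that by auto
  show ?thesis
  proof (rule ccontr)
    assume h: "\<not> g dvd h"
    define I where "I = {r. \<exists>a b. r = a * g + b * h}"
    have I_I: "a * g + b * h \<in> I" for a b
      unfolding I_def by blast
    have "g \<in> I" "h \<in> I"
      using I_I[of 1 0] I_I[of 0 1] by simp_all
    have "g \<noteq> 0"
      using g by auto
    obtain r where r: "r \<in> I" "r \<noteq> 0" and
      r_min: "\<And>s. s \<in> I \<Longrightarrow> s \<noteq> 0 \<Longrightarrow> degree r \<le> degree s"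
      using ex_has_least_nat[of "\<lambda>r. r \<in> I \<and> r \<noteq> 0" g degree] \<open>g \<in> I\<close> \<open>g \<noteq> 0\<close> by blast
    have div: "\<exists>c q. c \<noteq> 0 \<and> [:c:] * f = r * q" if f: "f \<in> I" for f
    proof -
      obtain q s where qs: "pseudo_divmod f r = (q, s)"
        by fastforce
      define c where "c = coeff r (degree r) ^ (Suc (degree f) - degree r)"
      have eq: "smult c f = r * q + s" and s: "s = 0 \<or> degree s < degree r"
        using pseudo_divmod[OF r(2) qs] by (simp_all add: c_def)
      obtain a b where "r = a * g + b * h"
        using r(1) by (auto simp: I_def)
      moreover obtain a' b' where "f = a' * g + b' * h"
        using f by (auto simp: I_def)
      moreover have "s = [:c:] * f - q * r"
        using eq by (simp add: algebra_simps)
      ultimately have "s = ([:c:] * a' - q * a) * g + ([:c:] * b' - q * b) * h"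
        by (simp only: algebra_simps)
      then have "s \<in> I"
        using I_I by blast
      then have "s = 0"
        using s r_min[of s] by fastforce
      moreover have "c \<noteq> 0"
        using r(2) by (simp add: c_def)
      moreover have "[:c:] * f = r * q"
        using eq \<open>s = 0\<close> by simp
      ultimately show ?thesis
        by blast
    qed
    \<comment> \<open>The prime \<open>g\<close> divides \<open>r q\<close>; it cannot divide \<open>r\<close>, or else it would divide \<open>h\<close>.\<close>
    obtain c q where cq: "c \<noteq> 0" "[:c:] * g = r * q"
      using div[OF \<open>g \<in> I\<close>] by blast
    have "\<not> g dvd r"
    proof
      assume gr: "g dvd r"
      obtain c' q' where "c' \<noteq> 0" "[:c':] * h = r * q'"
        using div[OF \<open>h \<in> I\<close>] by blast
      then have "g dvd [:c':] * h"
        using gr by auto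
      then show False
        using prime_elem_dvd_multD[OF prime] g_ndvd[OF \<open>c' \<noteq> 0\<close>] h by blast
    qed
    moreover have "g dvd r * q"
      using cq(2) by (metis dvd_triv_right)
    ultimately have "g dvd q"
      using prime_elem_dvd_multD[OF prime] by blast
    then obtain k where "q = g * k"
      by (rule dvdE)
    then have "[:c:] = r * k"
      using cq(2) \<open>g \<noteq> 0\<close> by (metis mult.assoc mult.commute mult_left_cancel)
    then have "r dvd [:c:]"
      by simp
    then have "degree r = 0"
      using dvd_imp_degree_le[of r "[:c:]"] cq(1) by simp
    then obtain d where d: "r = [:d:]"
      by (rule degree_eq_zeroE)
    then have "d \<noteq> 0"
      using r(2) by simp
    then have "d * lead_coeff g \<noteq> 0"
      using \<open>g \<noteq> 0\<close> by simp
    \<comment> \<open>A line on which neither \<open>r\<close> nor the leading coefficient of \<open>g\<close> vanishes.\<close>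
    then obtain y1 where y1: "poly (d * lead_coeff g) y1 \<noteq> 0"
      using poly_all_0_iff_0 by blast
    \<comment> \<open>The restriction of \<open>g\<close> to this vertical line keeps its degree, so it has a root.\<close>
    define gy where "gy = map_poly (\<lambda>c. poly c y1) g"
    have "coeff gy (degree g) \<noteq> 0"
      using y1 by (simp add: gy_def coeff_map_poly)
    then have "degree gy > 0"
      using False le_degree by fastforce
    then obtain y2 where "poly gy y2 = 0"
      using alg_closed_imp_poly_has_root by blast
    then have "eval2 g y1 y2 = 0"
      by (simp add: gy_def eval2_conv_map_poly)
    moreover obtain a b where "r = a * g + b * h"
      using r(1) by (auto simp: I_def)
    ultimately have "eval2 r y1 y2 = 0"
      using van by simp
    then show False
      using y1 by (simp add: d eval2_def)
  qed
qed


section \<open>Coefficients and homogenization\<close>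

lemma coeff2_simps [simp]:
  "coeff2 0 i j = 0"
  "coeff2 (p + q) i j = coeff2 p i j + coeff2 q i j"
  "coeff2 (p - q) i j = coeff2 p i j - coeff2 q i j"
  "coeff2 (sum f I) i j = (\<Sum>k\<in>I. coeff2 (f k) i j)"
  "coeff2 (monom (monom c s) t) i j = (if i = s \<and> j = t then c else 0)"
  by (auto simp: coeff2_def coeff_sum coeff_monom)

lemma eval2_monom [simp]: "eval2 (monom (monom c i) j) y1 y2 = c * y1 ^ i * y2 ^ j"
  by (simp add: eval2_def poly_monom)

lemma eval3_simps [simp]:
  "eval3 (p * q) x0 x1 x2 = eval3 p x0 x1 x2 * eval3 q x0 x1 x2"
  "eval3 (p ^ k) x0 x1 x2 = eval3 p x0 x1 x2 ^ k"
  "eval3 (sum f I) x0 x1 x2 = (\<Sum>i\<in>I. eval3 (f i) x0 x1 x2)"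
  "eval3 (const3 c) x0 x1 x2 = c" "eval3 varX0 x0 x1 x2 = x0"
  "eval3 varX1 x0 x1 x2 = x1" "eval3 varX2 x0 x1 x2 = x2"
  by (simp_all add: eval3_def const3_def varX0_def varX1_def varX2_def poly_sum)

lemma finite_bounded_pairs: "finite {(i, j). i + j \<le> (n :: nat)}"
  by (rule finite_subset[of _ "{..n} \<times> {..n}"]) auto

lemma finite_mindices [simp]: "finite (mindices n)"
  by (rule finite_subset[OF _ finite_bounded_pairs[of n]]) (auto simp: mindices_def)

lemma coeff2_nonzero_le_total_degree2:
  assumes "coeff2 p i j \<noteq> 0"
  shows "i + j \<le> total_degree2 p"
proof -
  have "{i + j | i j. coeff2 p i j \<noteq> 0} \<subseteq>
      (\<lambda>(j, i). i + j) ` (SIGMA j:{..degree p}. {..degree (coeff p j)})"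
  proof
    fix d assume "d \<in> {i + j | i j. coeff2 p i j \<noteq> 0}"
    then obtain i j where d: "d = i + j" and c: "coeff2 p i j \<noteq> 0"
      by blast
    then have "coeff p j \<noteq> 0"
      by (auto simp: coeff2_def)
    then have "j \<le> degree p" "i \<le> degree (coeff p j)"
      using c by (auto simp: coeff2_def intro: le_degree)
    then show "d \<in> (\<lambda>(j, i). i + j) ` (SIGMA j:{..degree p}. {..degree (coeff p j)})"
      by (intro image_eqI[of _ _ "(j, i)"]) (auto simp: d)
  qed
  then have "finite {i + j | i j. coeff2 p i j \<noteq> 0}"
    by (rule finite_subset) auto
  then show ?thesis
    unfolding total_degree2_def using assms by (intro Max_ge) auto
qed

lemma eval2_eq_sum_coeff2:
  assumes "total_degree2 p \<le> n"
  shows "eval2 p y1 y2 = (\<Sum>(i, j)\<in>{(i, j). i + j \<le> n}. coeff2 p i j * y1 ^ i * y2 ^ j)"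
proof -
  let ?q = "\<Sum>ij\<in>{(i, j). i + j \<le> n}. monom (monom (coeff2 p (fst ij) (snd ij)) (fst ij)) (snd ij)"
  have "coeff2 p s t = coeff2 ?q s t" for s t
  proof -
    have "coeff2 ?q s t = (\<Sum>ij\<in>{(i, j). i + j \<le> n}. if ij = (s, t) then coeff2 p s t else 0)"
      by (auto intro!: sum.cong)
    also have "\<dots> = coeff2 p s t"
      using coeff2_nonzero_le_total_degree2[of p s t] assms
      by (cases "coeff2 p s t = 0") (simp_all add: sum.delta[OF finite_bounded_pairs])
    finally show ?thesis ..
  qed
  then have "p = ?q"
    by (intro poly_eqI) (metis coeff2_def)
  then have "eval2 p y1 y2 = eval2 ?q y1 y2"
    by (rule arg_cong)
  then show ?thesis
    by (simp add: case_prod_beta)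
qed

lemma eval3_homogenize:
  assumes "total_degree2 p \<le> n" "x0 \<noteq> 0"
  shows "eval3 (homogenize n p) x0 x1 x2 = x0 ^ n * eval2 p (x1 / x0) (x2 / x0)"
proof -
  have "x0 ^ (n - (i + j)) = x0 ^ n / (x0 ^ i * x0 ^ j)" if "i + j \<le> n" for i j
    using that assms(2) by (simp add: power_diff power_add)
  then show ?thesis
    unfolding eval2_eq_sum_coeff2[OF assms(1)] homogenize_def sum_distrib_left eval3_simps(3)
    by (intro sum.cong refl) (auto simp: power_divide)
qed

text \<open>
  Clears denominators in \<open>p(q\<^sub>1/q\<^sub>0, q\<^sub>2/q\<^sub>0)\<close>.
\<close>

lemma homogenize_substitute:
  "\<exists>h. \<forall>y1 y2. eval2 h y1 y2 =
    eval3 (homogenize n p) (eval2 q0 y1 y2) (eval2 q1 y1 y2) (eval2 q2 y1 y2)"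
  by (rule exI[of _ "\<Sum>ij\<in>{(i, j). i + j \<le> n}. const2 (coeff2 p (fst ij) (snd ij)) *
      q0 ^ (n - (fst ij + snd ij)) * q1 ^ fst ij * q2 ^ snd ij"])
    (simp add: homogenize_def case_prod_beta)


section \<open>Functionals and relations between two linear forms\<close>

text \<open>
  A discrete Poincare lemma: the forward differences of \<open>m\<close> in the two directions, twisted by \<open>y1\<close>
  and \<open>y2\<close>, are prescribed, and the compatibility condition says that the prescription is closed.  The potential is built along the axis \<open>i = 0\<close> with \<open>l2\<close> and from there with \<open>l1\<close>;
  induction on \<open>i\<close> carries the second recurrence away from the axis.
\<close>

lemma recurrence_potential:
  fixes l1 l2 :: "mindex \<Rightarrow> complex"
  assumes compat: "\<And>i k. Suc (i + k) < n \<Longrightarrow>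
    l2 (Suc i, k) - y1 * l2 (i, k) = l1 (i, Suc k) - y2 * l1 (i, k)"
  obtains m where "\<And>i k. m (Suc i) k - y1 * m i k = l1 (i, k)"
    and "\<And>i k. i + k < n \<Longrightarrow> m i (Suc k) - y2 * m i k = l2 (i, k)"
proof -
  define m where "m = (rec_nat (rec_nat 0 (\<lambda>k v. y2 * v + l2 (0, k)))
    (\<lambda>i f k. y1 * f k + l1 (i, k)) :: nat \<Rightarrow> nat \<Rightarrow> complex)"
  have m_0: "m 0 (Suc k) = y2 * m 0 k + l2 (0, k)" for k
    by (simp add: m_def)
  have m_Suc: "m (Suc i) k = y1 * m i k + l1 (i, k)" for i k
    by (simp add: m_def)
  have "m i (Suc k) - y2 * m i k = l2 (i, k)" if "i + k < n" for i k
    using that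
  proof (induction i)
    case 0
    show ?case by (simp add: m_0)
  next
    case (Suc i)
    have "m (Suc i) (Suc k) - y2 * m (Suc i) k =
        y1 * (m i (Suc k) - y2 * m i k) + (l1 (i, Suc k) - y2 * l1 (i, k))"
      by (simp add: m_Suc algebra_simps)
    also have "\<dots> = y1 * l2 (i, k) + (l2 (Suc i, k) - y1 * l2 (i, k))"
      using Suc compat[of i k] by simp
    finally show ?case by simp
  qed
  then show thesis
    by (intro that[of m]) (simp_all add: m_Suc)
qed

text \<open>
  With the potential \<open>m\<close> of the two functionals, the sum is \<open>m\<close> applied to the polynomial
  \<open>a\<^sub>1 (x\<^sub>1 - y\<^sub>1) + a\<^sub>2 (x\<^sub>2 - y\<^sub>2)\<close>, which is zero.  The potential replaces a direct solution of this
  relation, where \<open>(a\<^sub>1, a\<^sub>2)\<close> would have to be shown to be a multiple of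
  \<open>(x\<^sub>2 - y\<^sub>2, -(x\<^sub>1 - y\<^sub>1))\<close> with control of its degree.
\<close>

lemma koszul_pairing_eq_0:
  fixes a1 a2 l1 l2 :: "mindex \<Rightarrow> complex"
  assumes compat: "\<And>i k. Suc (i + k) < n \<Longrightarrow>
      l2 (Suc i, k) - y1 * l2 (i, k) = l1 (i, Suc k) - y2 * l1 (i, k)"
    and rel: "\<And>x1 x2. (\<Sum>i\<in>mindices n. (a1 i * (x1 - y1) + a2 i * (x2 - y2)) *
      (x1 ^ fst i * x2 ^ snd i)) = 0"
  shows "(\<Sum>i\<in>mindices n. a1 i * l1 i + a2 i * l2 i) = 0"
proof -
  obtain m where m1: "\<And>i k. m (Suc i) k - y1 * m i k = l1 (i, k)"
    and m2: "\<And>i k. i + k < n \<Longrightarrow> m i (Suc k) - y2 * m i k = l2 (i, k)"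
    using recurrence_potential[OF compat] by blast
  \<comment> \<open>The bound \<open>n\<close> is attained: multiplication by a linear form raises the degree from \<open>n - 1\<close>.\<close>
  define L where "L p = (\<Sum>s\<le>n. \<Sum>t\<le>n. coeff2 p s t * m s t)" for p
  have L_simps: "L (p + q) = L p + L q" "L (p - q) = L p - L q"
      "L (sum f I) = (\<Sum>i\<in>I. L (f i))" for p q I and f :: "mindex \<Rightarrow> poly2"
    by (simp_all add: L_def sum.distrib sum_subtractf ring_distribs sum_distrib_right
        sum.swap[of _ _ I])
  have L_monom: "L (monom (monom c s) t) = c * m s t" if "s \<le> n" "t \<le> n" for c s t
  proof -
    have "L (monom (monom c s) t) =
        (\<Sum>i\<le>n. \<Sum>j\<le>n. if j = t then (if i = s then c * m s t else 0) else 0)"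
      unfolding L_def coeff2_simps by (intro sum.cong refl) auto
    also have "\<dots> = c * m s t"
      using that by simp
    finally show ?thesis .
  qed
  define p where "p = (\<Sum>i\<in>mindices n.
      (monom (monom (a1 i) (Suc (fst i))) (snd i) - monom (monom (y1 * a1 i) (fst i)) (snd i)) +
      (monom (monom (a2 i) (fst i)) (Suc (snd i)) - monom (monom (y2 * a2 i) (fst i)) (snd i)))"
  have "eval2 p x1 x2 = (\<Sum>i\<in>mindices n. (a1 i * (x1 - y1) + a2 i * (x2 - y2)) *
      (x1 ^ fst i * x2 ^ snd i))" for x1 x2
    unfolding p_def eval2_simps by (intro sum.cong) (simp_all add: algebra_simps)
  then have "p = 0"
    using rel by (intro eval2_eq_0_imp_eq_0) simp
  then have "0 = L p"
    by (simp add: L_def)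
  also have "\<dots> = (\<Sum>i\<in>mindices n. a1 i * (m (Suc (fst i)) (snd i) - y1 * m (fst i) (snd i)) +
      a2 i * (m (fst i) (Suc (snd i)) - y2 * m (fst i) (snd i)))"
    unfolding p_def L_simps
    by (intro sum.cong) (auto simp: L_monom mindices_def algebra_simps)
  also have "\<dots> = (\<Sum>i\<in>mindices n. a1 i * l1 i + a2 i * l2 i)"
    by (intro sum.cong) (auto simp: m1 m2 mindices_def)
  finally show ?thesis ..
qed


section \<open>The principal subspace\<close>

lemma lookup_family:
  "Poly_Mapping.lookup (family n f) i = (if i \<in> mindices n then f i else 0)"
  by (simp add: family_def lookup_sum lookup_single when_def)

lemma commutative_vesselD:
  assumes "commutative_vessel V"
  shows "fin_dim_space (ext_space V)" "selfadjoint_on (ext_space V) (sigma1 V)"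
    "selfadjoint_on (ext_space V) (sigma2 V)" "selfadjoint_on (ext_space V) (gamma_in V)"
    "operator_on (ext_space V) (sigma1 V)" "operator_on (ext_space V) (sigma2 V)"
    "operator_on (ext_space V) (gamma_in V)"
  using assms by (auto simp: commutative_vessel_def selfadjoint_on_def)

lemma operator_on_0: "operator_on E T \<Longrightarrow> complex_vector.subspace E \<Longrightarrow> T 0 = 0"
  using operator_on_sum[of E T "{}"] by simp

lemma subspace_principal_subspace:
  assumes V: "commutative_vessel V"
  shows "complex_vector.subspace (principal_subspace n V)"
proof -
  note V' = commutative_vesselD[OF V]
  note E = fin_dim_space_subspace[OF V'(1)]
  note lin = V'(5-7)[unfolded operator_on_def]
  show ?thesis
  proof (rule complex_vector.subspaceI)
    show "0 \<in> principal_subspace n V"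
      using E V'(5-7)[THEN operator_on_0, OF E]
      by (simp add: principal_subspace_def complex_vector.subspace_0)
    fix v w assume v: "v \<in> principal_subspace n V" and w: "w \<in> principal_subspace n V"
    have keys: "Poly_Mapping.keys (v + w) \<subseteq> mindices n"
      using v w Poly_Mapping.keys_add[of v w] by (auto simp: principal_subspace_def)
    have eq: "sigma2 V (Poly_Mapping.lookup (v + w) (Suc i1, i2))
        - sigma1 V (Poly_Mapping.lookup (v + w) (i1, Suc i2))
        + gamma_in V (Poly_Mapping.lookup (v + w) (i1, i2)) = 0" if "Suc (i1 + i2) < n" for i1 i2
    proof -
      let ?R = "\<lambda>w. sigma2 V (Poly_Mapping.lookup w (Suc i1, i2))
        - sigma1 V (Poly_Mapping.lookup w (i1, Suc i2)) + gamma_in V (Poly_Mapping.lookup w (i1, i2))"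
      have "?R (v + w) = ?R v + ?R w"
        using v w lin by (simp add: lookup_add principal_subspace_def)
      also have "\<dots> = 0"
        using v w that by (simp add: principal_subspace_def)
      finally show ?thesis .
    qed
    show "v + w \<in> principal_subspace n V"
      unfolding principal_subspace_def using v w keys eq E
      by (simp add: principal_subspace_def lookup_add complex_vector.subspace_add)
  next
    fix c v assume v: "v \<in> principal_subspace n V"
    have keys: "Poly_Mapping.keys (c *\<^sub>C v) \<subseteq> mindices n"
      using v by (auto simp: principal_subspace_def in_keys_iff lookup_scaleC)
    have eq: "sigma2 V (Poly_Mapping.lookup (c *\<^sub>C v) (Suc i1, i2))
        - sigma1 V (Poly_Mapping.lookup (c *\<^sub>C v) (i1, Suc i2))
        + gamma_in V (Poly_Mapping.lookup (c *\<^sub>C v) (i1, i2)) = 0" if "Suc (i1 + i2) < n" for i1 i2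
    proof -
      let ?R = "\<lambda>w. sigma2 V (Poly_Mapping.lookup w (Suc i1, i2))
        - sigma1 V (Poly_Mapping.lookup w (i1, Suc i2)) + gamma_in V (Poly_Mapping.lookup w (i1, i2))"
      have "?R (c *\<^sub>C v) = c *\<^sub>C ?R v"
        using v lin by (simp add: lookup_scaleC principal_subspace_def
            complex_vector.scale_right_distrib complex_vector.scale_right_diff_distrib)
      also have "\<dots> = 0"
        using v that by (simp add: principal_subspace_def)
      finally show ?thesis .
    qed
    show "c *\<^sub>C v \<in> principal_subspace n V"
      unfolding principal_subspace_def using v keys eq E
      by (simp add: principal_subspace_def lookup_scaleC complex_vector.subspace_scale)
  qed
qed

text \<open>
  All of its elements are combinations of single entries taken from a finite spanning set of
  \<open>E\<close>.
\<close>

lemma fin_dim_principal_subspace: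
  fixes V :: "('h::chilbert, 'e::complex_inner) vessel"
  assumes V: "commutative_vessel V"
  shows "fin_dim_space (principal_subspace n V)"
proof -
  obtain B where B: "finite B" "complex_vector.span B = ext_space V"
    using commutative_vesselD(1)[OF V] by (auto simp: fin_dim_space_def)
  define A where "A = (\<Union>i\<in>mindices n. Poly_Mapping.single i ` B)"
  have single: "Poly_Mapping.single i e \<in> complex_vector.span A"
    if "i \<in> mindices n" "e \<in> ext_space V" for i e
  proof -
    have "complex_vector.subspace {e :: 'e. Poly_Mapping.single i e \<in> complex_vector.span A}"
    proof (rule complex_vector.subspaceI)
      fix c and e :: 'e
      have "Poly_Mapping.single i (c *\<^sub>C e) = c *\<^sub>C Poly_Mapping.single i e"
        by (intro poly_mapping_eqI) (simp add: lookup_scaleC lookup_single when_def)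
      moreover assume "e \<in> {e. Poly_Mapping.single i e \<in> complex_vector.span A}"
      ultimately show "c *\<^sub>C e \<in> {e. Poly_Mapping.single i e \<in> complex_vector.span A}"
        by (simp add: complex_vector.span_scale)
    qed (simp_all add: complex_vector.span_zero single_add complex_vector.span_add)
    moreover have "B \<subseteq> {e. Poly_Mapping.single i e \<in> complex_vector.span A}"
      using that(1) by (auto simp: A_def intro!: complex_vector.span_base)
    ultimately have "complex_vector.span B \<subseteq> {e. Poly_Mapping.single i e \<in> complex_vector.span A}"
      by (rule complex_vector.span_minimal[rotated])
    then show ?thesis
      using B(2) that(2) by blast
  qed
  have "principal_subspace n V \<subseteq> complex_vector.span A"
  proof
    fix w assume w: "w \<in> principal_subspace n V"
    have "w = (\<Sum>i\<in>mindices n. Poly_Mapping.single i (Poly_Mapping.lookup w i))"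
      using w by (intro poly_mapping_eqI)
        (auto simp: lookup_sum lookup_single when_def principal_subspace_def in_keys_iff)
    moreover have "\<dots> \<in> complex_vector.span A"
      using w single by (intro complex_vector.span_sum) (auto simp: principal_subspace_def)
    ultimately show "w \<in> complex_vector.span A"
      by simp
  qed
  moreover have "finite A"
    using B(1) by (simp add: A_def)
  ultimately show ?thesis
    using subspace_of_span_fin_dim[OF subspace_principal_subspace[OF V]] by blast
qed

lemma lookup_principal_subspace:
  "w \<in> principal_subspace n V \<Longrightarrow> Poly_Mapping.lookup w j \<in> ext_space V"
  unfolding principal_subspace_def by blast

lemma bezout_op_add:
  assumes V: "commutative_vessel V" and "v \<in> principal_subspace n V" "w \<in> principal_subspace n V"
  shows "bezout_op n V b (v + w) = bezout_op n V b v + bezout_op n V b w"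
  using assms(2,3)[THEN lookup_principal_subspace] commutative_vesselD(5-7)[OF V]
  by (intro poly_mapping_eqI) (simp add: bezout_op_def lookup_family lookup_add operator_on_def
      complex_vector.scale_right_distrib sum.distrib algebra_simps split: prod.split)

lemma bezout_op_scaleC:
  assumes V: "commutative_vessel V" and "w \<in> principal_subspace n V"
  shows "bezout_op n V b (c *\<^sub>C w) = c *\<^sub>C bezout_op n V b w"
  using assms(2)[THEN lookup_principal_subspace] commutative_vesselD(5-7)[OF V]
  by (intro poly_mapping_eqI) (simp add: bezout_op_def lookup_family lookup_scaleC operator_on_def
      complex_vector.scale_right_distrib complex_vector.scale_sum_right mult.commute
      split: prod.split)

lemma operator_on_compressed_bezout_op:
  assumes V: "commutative_vessel V"
  shows "operator_on (principal_subspace n V) (compressed_bezout_op n V b)"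
proof -
  note fd = fin_dim_principal_subspace[OF V, of n]
  note sub = subspace_principal_subspace[OF V, of n]
  show ?thesis
    unfolding operator_on_def compressed_bezout_op_def
    by (simp add: orth_proj_of_mem[OF fd] complex_vector.subspace_add[OF sub]
        complex_vector.subspace_scale[OF sub] bezout_op_add[OF V] bezout_op_scaleC[OF V]
        orth_proj_add[OF fd] orth_proj_scaleC[OF fd] orth_proj(1)[OF fd])
qed

text \<open>
  For \<open>u\<close> in the kernel of the pencil at \<open>(y\<^sub>1, y\<^sub>2)\<close>, these vectors are the image of the point under
  the Veronese embedding of degree \<open>n - 1\<close>, tensored with \<open>u\<close>.
\<close>

definition point_vector :: "nat \<Rightarrow> complex \<Rightarrow> complex \<Rightarrow> 'e \<Rightarrow> mindex \<Rightarrow>\<^sub>0 'e::complex_inner"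
  where "point_vector n y1 y2 u = family n (\<lambda>i. (y1 ^ fst i * y2 ^ snd i) *\<^sub>C u)"

lemma point_vector_principal_subspace:
  assumes V: "commutative_vessel V" and u: "u \<in> ext_space V"
    and ker: "y1 *\<^sub>C sigma2 V u - y2 *\<^sub>C sigma1 V u + gamma_in V u = 0"
  shows "point_vector n y1 y2 u \<in> principal_subspace n V"
proof -
  note V' = commutative_vesselD[OF V]
  note E = fin_dim_space_subspace[OF V'(1)]
  have "sigma2 V (Poly_Mapping.lookup (point_vector n y1 y2 u) (Suc i, k))
      - sigma1 V (Poly_Mapping.lookup (point_vector n y1 y2 u) (i, Suc k))
      + gamma_in V (Poly_Mapping.lookup (point_vector n y1 y2 u) (i, k)) = 0"
    if "Suc (i + k) < n" for i k
  proof -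
    have "sigma2 V (Poly_Mapping.lookup (point_vector n y1 y2 u) (Suc i, k))
      - sigma1 V (Poly_Mapping.lookup (point_vector n y1 y2 u) (i, Suc k))
      + gamma_in V (Poly_Mapping.lookup (point_vector n y1 y2 u) (i, k)) =
      (y1 ^ i * y2 ^ k) *\<^sub>C (y1 *\<^sub>C sigma2 V u - y2 *\<^sub>C sigma1 V u + gamma_in V u)"
      using that u V'(5-7)
      by (simp add: point_vector_def lookup_family mindices_def operator_on_def
          complex_vector.scale_right_distrib complex_vector.scale_right_diff_distrib algebra_simps)
    then show ?thesis
      by (simp add: ker)
  qed
  moreover have "Poly_Mapping.keys (point_vector n y1 y2 u) \<subseteq> mindices n"
    by (auto simp: point_vector_def in_keys_iff lookup_family split: if_splits)
  ultimately show ?thesis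
    using u E by (simp add: principal_subspace_def point_vector_def lookup_family
        complex_vector.subspace_scale complex_vector.subspace_0)
qed

lemma point_vector_nonzero:
  assumes "n > 0" "u \<noteq> 0"
  shows "point_vector n y1 y2 u \<noteq> 0"
proof
  assume "point_vector n y1 y2 u = 0"
  then have "Poly_Mapping.lookup (point_vector n y1 y2 u) (0, 0) = 0"
    by simp
  then show False
    using assms by (simp add: point_vector_def lookup_family mindices_def)
qed


section \<open>Generalized Bezout matrices at a point of the curve\<close>

text \<open>
  The coefficients of \<open>x\<^sup>i (x\<^sub>1 - y\<^sub>1)\<close> and \<open>x\<^sup>i (x\<^sub>2 - y\<^sub>2)\<close> that remain when the third Bezout matrix is
  absorbed into the first two at a fixed point \<open>(1, y\<^sub>1, y\<^sub>2)\<close>.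
\<close>

definition bezout_coeff1 ::
    "nat \<Rightarrow> bmatrix \<times> bmatrix \<times> bmatrix \<Rightarrow> complex \<Rightarrow> complex \<Rightarrow> mindex \<Rightarrow> complex"
  where "bezout_coeff1 n = (\<lambda>(b10, b20, b12) y1 y2 i.
    \<Sum>j\<in>mindices n. (b10 i j + y2 * b12 i j) * (y1 ^ fst j * y2 ^ snd j))"

definition bezout_coeff2 ::
    "nat \<Rightarrow> bmatrix \<times> bmatrix \<times> bmatrix \<Rightarrow> complex \<Rightarrow> complex \<Rightarrow> mindex \<Rightarrow> complex"
  where "bezout_coeff2 n = (\<lambda>(b10, b20, b12) y1 y2 i.
    \<Sum>j\<in>mindices n. (b20 i j - y1 * b12 i j) * (y1 ^ fst j * y2 ^ snd j))"

text \<open>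
  The Bezoutian at \<open>x = (1, x\<^sub>1, x\<^sub>2)\<close>, \<open>y = (1, y\<^sub>1, y\<^sub>2)\<close>, rewritten with
  \<open>x\<^sub>1 y\<^sub>2 - x\<^sub>2 y\<^sub>1 = y\<^sub>2 (x\<^sub>1 - y\<^sub>1) - y\<^sub>1 (x\<^sub>2 - y\<^sub>2)\<close>.
\<close>

lemma bezout_matrices_at_point:
  assumes "bezout_matrices n p q b"
  shows "(\<Sum>i\<in>mindices n. (bezout_coeff1 n b y1 y2 i * (x1 - y1) +
      bezout_coeff2 n b y1 y2 i * (x2 - y2)) * (x1 ^ fst i * x2 ^ snd i)) =
    eval3 p 1 x1 x2 * eval3 q 1 y1 y2 - eval3 q 1 x1 x2 * eval3 p 1 y1 y2"
proof -
  obtain b10 b20 b12 where b: "b = (b10, b20, b12)"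
    by (cases b) auto
  let ?x = "\<lambda>i. x1 ^ fst i * x2 ^ snd i" and ?y = "\<lambda>j. y1 ^ fst j * y2 ^ snd j"
  have "eval3 p 1 x1 x2 * eval3 q 1 y1 y2 - eval3 q 1 x1 x2 * eval3 p 1 y1 y2 =
      (\<Sum>i\<in>mindices n. \<Sum>j\<in>mindices n. b10 i j * ?x i * (x1 - y1) * ?y j
        + b20 i j * ?x i * (x2 - y2) * ?y j + b12 i j * ?x i * (x1 * y2 - x2 * y1) * ?y j)"
    using assms by (simp add: bezout_matrices_def b monom3_def)
  also have "\<dots> = (\<Sum>i\<in>mindices n. (bezout_coeff1 n b y1 y2 i * (x1 - y1) +
      bezout_coeff2 n b y1 y2 i * (x2 - y2)) * ?x i)"
    unfolding bezout_coeff1_def bezout_coeff2_def b prod.case sum_distrib_right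
      sum.distrib[symmetric]
    by (intro sum.cong refl) (simp add: algebra_simps)
  finally show ?thesis ..
qed

text \<open>
  The equation \<open>\<gamma> u = y\<^sub>2 \<sigma>\<^sub>1 u - y\<^sub>1 \<sigma>\<^sub>2 u\<close> has the coefficients of
  \<open>x\<^sub>1 y\<^sub>2 - x\<^sub>2 y\<^sub>1 = y\<^sub>2 (x\<^sub>1 - y\<^sub>1) - y\<^sub>1 (x\<^sub>2 - y\<^sub>2)\<close>.  Thus the terms with \<open>\<gamma>\<close> are absorbed into those
  with \<open>\<sigma>\<^sub>1\<close> and \<open>\<sigma>\<^sub>2\<close> exactly as the third Bezout matrix is absorbed into the first two.
\<close>

lemma cinner_bezout_op_point_vector:
  assumes V: "commutative_vessel V" and u: "u \<in> ext_space V"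
    and ker: "y1 *\<^sub>C sigma2 V u - y2 *\<^sub>C sigma1 V u + gamma_in V u = 0"
  shows "cinner (bezout_op n V b (point_vector n y1 y2 u)) z =
    (\<Sum>i\<in>mindices n. bezout_coeff1 n b y1 y2 i * cinner (sigma1 V u) (Poly_Mapping.lookup z i) +
      bezout_coeff2 n b y1 y2 i * cinner (sigma2 V u) (Poly_Mapping.lookup z i))"
proof -
  obtain b10 b20 b12 where b: "b = (b10, b20, b12)"
    by (cases b) auto
  note V' = commutative_vesselD[OF V]
  let ?y = "\<lambda>j. y1 ^ fst j * y2 ^ snd j"
  have "gamma_in V u = y2 *\<^sub>C sigma1 V u - y1 *\<^sub>C sigma2 V u"
    using ker by (simp add: algebra_simps eq_neg_iff_add_eq_0)
  then have gamma: "cinner (gamma_in V u) v = y2 * cinner (sigma1 V u) v - y1 * cinner (sigma2 V u) v"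
    for v
    by (simp add: cinner_diff_left cinner_scaleC_left)
  have keys: "Poly_Mapping.keys (bezout_op n V b (point_vector n y1 y2 u)) \<subseteq> mindices n"
    by (auto simp: bezout_op_def b in_keys_iff lookup_family split: if_splits)
  have lin: "T (Poly_Mapping.lookup (point_vector n y1 y2 u) j) = ?y j *\<^sub>C T u"
    if "operator_on (ext_space V) T" "j \<in> mindices n" for T j
    using that u by (simp add: point_vector_def lookup_family operator_on_def)
  have "cinner (bezout_op n V b (point_vector n y1 y2 u)) z =
      (\<Sum>i\<in>mindices n. \<Sum>j\<in>mindices n.
        b12 i j * (?y j * cinner (gamma_in V u) (Poly_Mapping.lookup z i)) +
        b10 i j * (?y j * cinner (sigma1 V u) (Poly_Mapping.lookup z i)) +
        b20 i j * (?y j * cinner (sigma2 V u) (Poly_Mapping.lookup z i)))"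
    unfolding cinner_poly_mapping_superset[OF finite_mindices keys]
    by (intro sum.cong refl) (simp add: bezout_op_def b lookup_family cinner_sum_left
        cinner_add_left cinner_scaleC_left lin[OF V'(5)] lin[OF V'(6)] lin[OF V'(7)]
        mult.assoc)
  also have "\<dots> = (\<Sum>i\<in>mindices n.
      bezout_coeff1 n b y1 y2 i * cinner (sigma1 V u) (Poly_Mapping.lookup z i) +
      bezout_coeff2 n b y1 y2 i * cinner (sigma2 V u) (Poly_Mapping.lookup z i))"
    unfolding bezout_coeff1_def bezout_coeff2_def b prod.case sum_distrib_right
      sum.distrib[symmetric] gamma
    by (intro sum.cong refl) (simp add: algebra_simps)
  finally show ?thesis .
qed

text \<open>
  It suffices that the uncompressed image is orthogonal to the principal subspace.  For \<open>z\<close> in it,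
  the equations of the subspace, moved to \<open>u\<close> by selfadjointness, are the compatibility condition of
  the pairing lemma; the combination of the three Bezoutians supplies its polynomial relation.
\<close>

lemma pencil_annihilates_point_vector:
  fixes V :: "('h::chilbert, 'e::complex_inner) vessel"
  assumes V: "commutative_vessel V" and u: "u \<in> ext_space V"
    and ker: "y1 *\<^sub>C sigma2 V u - y2 *\<^sub>C sigma1 V u + gamma_in V u = 0"
    and b: "bezout_matrices n P1 P0 b1" "bezout_matrices n P2 P0 b2" "bezout_matrices n P1 P2 b3"
    and P0: "eval3 P0 1 y1 y2 \<noteq> 0"
  shows "(eval3 P1 1 y1 y2 / eval3 P0 1 y1 y2) *\<^sub>C
        compressed_bezout_op n V b2 (point_vector n y1 y2 u)
      - (eval3 P2 1 y1 y2 / eval3 P0 1 y1 y2) *\<^sub>C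
        compressed_bezout_op n V b1 (point_vector n y1 y2 u)
      + compressed_bezout_op n V b3 (point_vector n y1 y2 u) = 0"
proof -
  let ?w = "point_vector n y1 y2 u"
  define t1 where "t1 = eval3 P1 1 y1 y2 / eval3 P0 1 y1 y2"
  define t2 where "t2 = eval3 P2 1 y1 y2 / eval3 P0 1 y1 y2"
  note fd = fin_dim_principal_subspace[OF V, of n]
  have w: "?w \<in> principal_subspace n V"
    by (rule point_vector_principal_subspace[OF V u ker])
  define v where "v = t1 *\<^sub>C bezout_op n V b2 ?w - t2 *\<^sub>C bezout_op n V b1 ?w + bezout_op n V b3 ?w"
  have "cinner v z = 0" if z: "z \<in> principal_subspace n V" for z
  proof -
    define l1 where "l1 i = cinner (sigma1 V u) (Poly_Mapping.lookup z i)" for i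
    define l2 where "l2 i = cinner (sigma2 V u) (Poly_Mapping.lookup z i)" for i
    define a1 where "a1 i = t1 * bezout_coeff1 n b2 y1 y2 i - t2 * bezout_coeff1 n b1 y1 y2 i
        + bezout_coeff1 n b3 y1 y2 i" for i
    define a2 where "a2 i = t1 * bezout_coeff2 n b2 y1 y2 i - t2 * bezout_coeff2 n b1 y1 y2 i
        + bezout_coeff2 n b3 y1 y2 i" for i
    have "l2 (Suc i, k) - y1 * l2 (i, k) = l1 (i, Suc k) - y2 * l1 (i, k)"
      if "Suc (i + k) < n" for i k
    proof -
      let ?z = "Poly_Mapping.lookup z"
      have "cinner u (sigma2 V (?z (Suc i, k)) - sigma1 V (?z (i, Suc k)) + gamma_in V (?z (i, k))) = 0"
        using z that by (simp add: principal_subspace_def)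
      moreover have "cinner u (x - y + x') = cinner u x - cinner u y + cinner u x'" for x y x'
        by (metis add_diff_cancel_right' cinner_add_right diff_add_cancel)
      moreover have "cinner u (T (?z j)) = cinner (T u) (?z j)"
        if "selfadjoint_on (ext_space V) T" for T j
        using that u lookup_principal_subspace[OF z] unfolding selfadjoint_on_def by metis
      ultimately have "l2 (Suc i, k) - l1 (i, Suc k) + cinner (gamma_in V u) (?z (i, k)) = 0"
        using commutative_vesselD(2-4)[OF V] by (simp add: l1_def l2_def)
      moreover have "gamma_in V u = y2 *\<^sub>C sigma1 V u - y1 *\<^sub>C sigma2 V u"
        using ker by (simp add: algebra_simps eq_neg_iff_add_eq_0)
      ultimately show ?thesis
        by (simp add: cinner_diff_left cinner_scaleC_left l1_def l2_def algebra_simps)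
    qed
    moreover have "(\<Sum>i\<in>mindices n. (a1 i * (x1 - y1) + a2 i * (x2 - y2)) *
        (x1 ^ fst i * x2 ^ snd i)) = 0" for x1 x2
    proof -
      let ?S = "\<lambda>b. \<Sum>i\<in>mindices n. (bezout_coeff1 n b y1 y2 i * (x1 - y1) +
        bezout_coeff2 n b y1 y2 i * (x2 - y2)) * (x1 ^ fst i * x2 ^ snd i)"
      have "(\<Sum>i\<in>mindices n. (a1 i * (x1 - y1) + a2 i * (x2 - y2)) * (x1 ^ fst i * x2 ^ snd i)) =
          t1 * ?S b2 - t2 * ?S b1 + ?S b3"
        unfolding sum_distrib_left sum.distrib[symmetric] sum_subtractf[symmetric] a1_def a2_def
        by (intro sum.cong refl) (simp add: algebra_simps)
      \<comment> \<open>The choice of \<open>t1\<close> and \<open>t2\<close> makes the three Bezoutians cancel.\<close>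
      also have "\<dots> = 0"
        unfolding b[THEN bezout_matrices_at_point] t1_def t2_def
        using P0 by (simp add: field_simps)
      finally show ?thesis .
    qed
    ultimately have "(\<Sum>i\<in>mindices n. a1 i * l1 i + a2 i * l2 i) = 0"
      by (rule koszul_pairing_eq_0)
    moreover have "cinner v z = (\<Sum>i\<in>mindices n. a1 i * l1 i + a2 i * l2 i)"
      unfolding v_def cinner_add_left cinner_diff_left cinner_scaleC_left
        cinner_bezout_op_point_vector[OF V u ker] sum_distrib_left sum.distrib[symmetric]
        sum_subtractf[symmetric] a1_def a2_def l1_def l2_def
      by (intro sum.cong refl) (simp add: algebra_simps)
    ultimately show ?thesis
      by simp
  qed
  then have "orth_proj (principal_subspace n V) v = 0"
    by (rule orth_proj_of_orthogonal[OF fd])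
  then show ?thesis
    by (simp add: compressed_bezout_op_def orth_proj_of_mem[OF fd w] v_def orth_proj_add[OF fd]
        orth_proj_diff[OF fd] orth_proj_scaleC[OF fd] t1_def t2_def)
qed


section \<open>From the image of the rational mapping to the whole curve\<close>

text \<open>
  The image contains every point of \<open>C'\<close> outside the zero set of \<open>q\<^sub>0 h\<close>, where \<open>h\<close> is the
  numerator of \<open>p\<^sub>0 \<circ> (q\<^sub>1/q\<^sub>0, q\<^sub>2/q\<^sub>0)\<close>.  Since the composition of the two rational mappings is defined
  somewhere on \<open>C'\<close>, \<open>q\<^sub>0 h\<close> is not divisible by the prime \<open>g\<close>.
\<close>

lemma birational_image_dense:
  assumes g: "irreducible g" and C': "C' = {(y1, y2). eval2 g y1 y2 = 0}"
    and bir: "birational_isomorphism C C' p0 p1 p2"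
    and f: "\<And>x. x \<in> rat_dom C p0 \<Longrightarrow>
      eval2 f (fst (rat_map p0 p1 p2 x)) (snd (rat_map p0 p1 p2 x)) = 0"
  shows "g dvd f"
proof -
  obtain q0 q1 q2 where q: "rational_mapping C' C q0 q1 q2"
      "rational_left_inverse C' C q0 q1 q2 p0 p1 p2"
    using bir by (auto simp: birational_isomorphism_def)
  obtain h where h: "\<And>y1 y2. eval2 h y1 y2 = eval3 (homogenize (total_degree2 p0) p0)
      (eval2 q0 y1 y2) (eval2 q1 y1 y2) (eval2 q2 y1 y2)"
    using homogenize_substitute by blast
  have h_iff: "eval2 h y1 y2 = 0 \<longleftrightarrow>
      eval2 p0 (eval2 q1 y1 y2 / eval2 q0 y1 y2) (eval2 q2 y1 y2 / eval2 q0 y1 y2) = 0"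
    if "eval2 q0 y1 y2 \<noteq> 0" for y1 y2
    using that by (simp add: h eval3_homogenize[OF order_refl])
  have "eval2 (f * (q0 * h)) y1 y2 = 0" if y: "eval2 g y1 y2 = 0" for y1 y2
  proof (cases "eval2 q0 y1 y2 = 0 \<or> eval2 h y1 y2 = 0")
    case True
    then show ?thesis by auto
  next
    case False
    define x where "x = rat_map q0 q1 q2 (y1, y2)"
    have dom: "(y1, y2) \<in> rat_dom C' q0"
      using False y by (simp add: rat_dom_def C')
    then have "x \<in> C"
      using q(1) by (auto simp: rational_mapping_def x_def)
    then have x: "x \<in> rat_dom C p0"
      using False h_iff[of y1 y2] by (auto simp: rat_dom_def x_def rat_map_def)
    then have "rat_map p0 p1 p2 x = (y1, y2)"
      using q(2) dom by (auto simp: rational_left_inverse_def x_def)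
    then show ?thesis
      using f[OF x] by simp
  qed
  then have "g dvd f * (q0 * h)"
    by (rule irreducible_dvd_if_vanishes[OF g])
  moreover have "\<not> g dvd q0 * h"
  proof
    assume "g dvd q0 * h"
    then obtain k where k: "q0 * h = g * k"
      by (rule dvdE)
    obtain y1 y2 where y: "(y1, y2) \<in> rat_dom C' q0" "rat_map q0 q1 q2 (y1, y2) \<in> rat_dom C p0"
      using q(2) by (auto simp: rational_left_inverse_def)
    then have "eval2 (q0 * h) y1 y2 \<noteq> 0"
      using h_iff[of y1 y2] by (auto simp: rat_dom_def rat_map_def)
    moreover have "eval2 (g * k) y1 y2 = 0"
      using y(1) by (simp add: rat_dom_def C')
    ultimately show False
      by (simp only: k)
  qed
  ultimately show ?thesis
    using prime_elem_dvd_multD[OF irreducible_imp_prime_elem[OF g]] by blast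
qed

text \<open>
  If \<open>r\<close> had a constant value \<open>(c\<^sub>1, c\<^sub>2)\<close>, then \<open>y\<^sub>1 - c\<^sub>1\<close> and \<open>y\<^sub>2 - c\<^sub>2\<close> would vanish on the
  image and thus be divisible by the equation of \<open>C'\<close>, although they are coprime.
\<close>

lemma birational_isomorphism_degree_pos:
  assumes C': "irreducible_plane_curve C'" and bir: "birational_isomorphism C C' p0 p1 p2"
    and deg: "total_degree2 p0 \<le> n" "total_degree2 p1 \<le> n" "total_degree2 p2 \<le> n"
  shows "n > 0"
proof (rule ccontr)
  assume "\<not> n > 0"
  then have const: "eval2 p y1 y2 = coeff2 p 0 0" if "total_degree2 p \<le> n" for p y1 y2
    using that eval2_eq_sum_coeff2[of p 0 y1 y2] by (simp add: case_prod_beta)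
  define c1 where "c1 = coeff2 p1 0 0 / coeff2 p0 0 0"
  define c2 where "c2 = coeff2 p2 0 0 / coeff2 p0 0 0"
  have r: "rat_map p0 p1 p2 x = (c1, c2)" for x
    using deg by (simp add: rat_map_def const c1_def c2_def case_prod_beta)
  obtain g where g: "irreducible g" "C' = {(y1, y2). eval2 g y1 y2 = 0}"
    using C' by (auto simp: irreducible_plane_curve_def)
  note dense = birational_image_dense[OF g bir, unfolded r]
  have "g dvd varY1 - const2 c1" "g dvd varY2 - const2 c2"
    by (rule dense; simp)+
  moreover have "varY1 - const2 c1 = [:[:- c1, 1:]:]" "varY2 - const2 c2 = [:[:- c2:], 1:]"
    by (simp_all add: varY1_def varY2_def const2_def)
  ultimately have dvd: "g dvd [:[:- c1, 1:]:]" "g dvd [:[:- c2:], 1:]"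
    by simp_all
  have "degree g = 0"
    using dvd_imp_degree_le[OF dvd(1)] by simp
  then obtain g0 where g0: "g = [:g0:]"
    by (rule degree_eq_zeroE)
  have "g0 dvd coeff [:[:- c2:], 1:] 1"
    using dvd(2) by (simp only: g0 const_poly_dvd_iff)
  then have "is_unit g"
    by (simp add: g0 is_unit_const_poly_iff)
  then show False
    using g(1) by (simp add: irreducible_def)
qed

theorem theorem3p2:
  fixes V :: "('h::chilbert, 'e::complex_inner) vessel"
    and p0 p1 p2 :: "complex poly poly"
    and C' :: "(complex \<times> complex) set"
    and n :: nat
    and b1 b2 b3 :: "bmatrix \<times> bmatrix \<times> bmatrix"
  assumes "commutative_vessel V"
    and "irreducible (disc_poly V)"
    and "irreducible (hom_disc_poly V)"
    and "real_poly2 p0" "real_poly2 p1" "real_poly2 p2"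
    and "invertible_op (poly_op p0 (op1 V) (op2 V))"
    and "irreducible_plane_curve C'"
    and "birational_isomorphism (discriminant_variety V) C' p0 p1 p2"
    and "n = max (total_degree2 p0) (max (total_degree2 p1) (total_degree2 p2))"
    and "bezout_matrices n (homogenize n p1) (homogenize n p0) b1"
    and "bezout_matrices n (homogenize n p2) (homogenize n p0) b2"
    and "bezout_matrices n (homogenize n p1) (homogenize n p2) b3"
  shows "C' \<subseteq> discriminant_variety (transformed_vessel V n p0 p1 p2 b1 b2 b3)"
proof -
  note V = assms(1)
  note bir = assms(9)
  let ?E' = "principal_subspace n V"
  let ?S = "compressed_bezout_op n V"
  have deg: "total_degree2 p0 \<le> n" "total_degree2 p1 \<le> n" "total_degree2 p2 \<le> n"
    using assms(10) by auto
  have n: "n > 0"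
    by (rule birational_isomorphism_degree_pos[OF assms(8) bir deg])
  have variety: "discriminant_variety (transformed_vessel V n p0 p1 p2 b1 b2 b3) =
      {(t1, t2). op_det ?E' (\<lambda>e. t1 *\<^sub>C ?S b2 e - t2 *\<^sub>C ?S b1 e + ?S b3 e) = 0}"
    by (simp add: discriminant_variety_def transformed_vessel_def Let_def)
  note fd = fin_dim_principal_subspace[OF V, of n]
  note op = operator_on_compressed_bezout_op[OF V, of n]
  obtain f where f: "\<And>t1 t2. eval2 f t1 t2 =
      op_det ?E' (\<lambda>e. t1 *\<^sub>C ?S b2 e - t2 *\<^sub>C ?S b1 e + ?S b3 e)"
    using pencil_det_is_polynomial[OF fd op op op] by blast
  have pencil: "operator_on E (\<lambda>e. t1 *\<^sub>C S2 e - t2 *\<^sub>C S1 e + G e)"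
    if "operator_on E S2" "operator_on E S1" "operator_on E G" "complex_vector.subspace E"
    for E :: "'a::complex_inner set" and S2 S1 G t1 t2
    using that by (auto simp: operator_on_def complex_vector.subspace_add
        complex_vector.subspace_diff complex_vector.subspace_scale
        complex_vector.scale_right_distrib complex_vector.scale_right_diff_distrib mult.commute)
  obtain g where g: "irreducible g" "C' = {(y1, y2). eval2 g y1 y2 = 0}"
    using assms(8) by (auto simp: irreducible_plane_curve_def)
  have "eval2 f (fst (rat_map p0 p1 p2 x)) (snd (rat_map p0 p1 p2 x)) = 0"
    if x: "x \<in> rat_dom (discriminant_variety V) p0" for x
  proof -
    obtain y1 y2 where y: "x = (y1, y2)" by (cases x)
    have p0: "eval2 p0 y1 y2 \<noteq> 0"
      using x by (simp add: y rat_dom_def)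
    note V' = commutative_vesselD[OF V]
    have "op_det (ext_space V) (\<lambda>e. y1 *\<^sub>C sigma2 V e - y2 *\<^sub>C sigma1 V e + gamma_in V e) = 0"
      using x by (simp add: y rat_dom_def discriminant_variety_def)
    then obtain u where u: "u \<in> ext_space V" "u \<noteq> 0"
        "y1 *\<^sub>C sigma2 V u - y2 *\<^sub>C sigma1 V u + gamma_in V u = 0"
      using op_det_eq_0_iff[OF V'(1) pencil[OF V'(6,5,7) fin_dim_space_subspace[OF V'(1)]]]
      by blast
    have hom: "eval3 (homogenize n p) 1 y1 y2 = eval2 p y1 y2" if "total_degree2 p \<le> n" for p
      using eval3_homogenize[OF that, of 1] by simp
    have "(eval2 p1 y1 y2 / eval2 p0 y1 y2) *\<^sub>C ?S b2 (point_vector n y1 y2 u)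
        - (eval2 p2 y1 y2 / eval2 p0 y1 y2) *\<^sub>C ?S b1 (point_vector n y1 y2 u)
        + ?S b3 (point_vector n y1 y2 u) = 0"
      using pencil_annihilates_point_vector[OF V u(1,3) assms(11-13)] p0 deg by (simp add: hom)
    then show ?thesis
      unfolding f y rat_map_def prod.case fst_conv snd_conv
        op_det_eq_0_iff[OF fd pencil[OF op op op subspace_principal_subspace[OF V]]]
      using point_vector_principal_subspace[OF V u(1,3)] point_vector_nonzero[OF n u(2)] by blast
  qed
  then have "g dvd f"
    by (rule birational_image_dense[OF g bir])
  then have "eval2 f t1 t2 = 0" if "(t1, t2) \<in> C'" for t1 t2
    using that by (auto simp: g(2) elim!: dvdE)
  then show ?thesis
    by (auto simp: variety f)
qed

end
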